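(* Let $(T,d)$ be a metric space, $m$ a Borel probability measure on $T$ with $\operatorname{supp}(m)=T$, $p\ge 1$ and $q=\frac{p}{p-1}$. Suppose that $m$ is a majorizing measure on $T$ with respect to $\varphi_p(x)=x^p$, i.e. $$\mathcal{S}:=\sup_{x\in T}\int_0^{D(T)}\left(\frac{1}{m(B(x,\varepsilon))}\right)^{1/p}d\varepsilon<\infty.$$ Then there exists a probability measure $\nu$ on $T\times T$ such that for all continuous functions $f:T\to\mathbb{R}$, $$\sup_{s,t\in T}|f(s)-f(t)|^p\le(2K_p)^p\int_{T\times T}\left(\frac{|f(u)-f(v)|}{d(u,v)}\right)^p\nu(du,dv),$$ where $K_p=2\left(\frac{3p-1}{p}\right)\left(3q-\frac{q}{p}\right)^{1/(2q)}\mathcal{S}$.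
   Context: $B(x,\varepsilon)=\{y\in T:d(x,y)\le\varepsilon\}$ is the closed ball and $D(T)=\sup\{d(s,t):s,t\in T\}$ the diameter of $T$. The convention $0/0=0$ is used (so the integrand is $0$ on the diagonal $u=v$). For $p=1$ one has $q=\infty$ and the factor $\left(3q-\frac{q}{p}\right)^{1/(2q)}$ is read as its limit $1$, so $K_1=4\mathcal{S}$. *)

theory Defs
  imports "HOL-Probability.Probability"
begin

definition measure_support :: "'a::topological_space measure \<Rightarrow> 'a set" where
  "measure_support m = {x. \<forall>U. open U \<and> x \<in> U \<longrightarrow> 0 < emeasure m U}"

text \<open>The diameter is taken in \<^typ>\<open>ennreal\<close>, since the library's real-valued
  \<^const>\<open>diameter\<close> is unspecified on unbounded sets.\<close>

definition ediameter :: "'a::metric_space set \<Rightarrow> ennreal" where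
  "ediameter A = (SUP s\<in>A. SUP t\<in>A. ennreal (dist s t))"

text \<open>The entropy integral for \<open>\<phi>(x) = x powr p\<close>, whose inverse is \<open>x powr (1/p)\<close>.
  The real quotient agrees with the extended one whenever every ball of positive radius has
  positive measure, i.e. whenever \<open>m\<close> has full support; the radius \<open>0\<close>, where
  the ball may be a null set, is left out of the range of integration.\<close>

definition majorizing_integral :: "'a::metric_space measure \<Rightarrow> real \<Rightarrow> 'a \<Rightarrow> ennreal" where
  "majorizing_integral m p x =
    (\<integral>\<^sup>+ \<epsilon> \<in> {\<epsilon>. 0 < \<epsilon> \<and> ennreal \<epsilon> \<le> ediameter (UNIV :: 'a set)}.
       ennreal ((1 / measure m (cball x \<epsilon>)) powr (1 / p)) \<partial>lborel)"

definition majorizing_sup :: "'a::metric_space measure \<Rightarrow> real \<Rightarrow> ennreal" where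
  "majorizing_sup m p = (SUP x. majorizing_integral m p x)"

text \<open>For \<open>p = 1\<close> the conjugate exponent \<open>q\<close> is infinite and the factor
  \<open>(3 * q - q / p) powr (1 / (2 * q))\<close> is read as its limit \<open>1\<close>.\<close>

definition K_factor :: "real \<Rightarrow> real" where
  "K_factor p = (if p = 1 then 1
     else let q = p / (p - 1) in (3 * q - q / p) powr (1 / (2 * q)))"

definition K_const :: "real \<Rightarrow> real \<Rightarrow> real" where
  "K_const p S = 2 * ((3 * p - 1) / p) * K_factor p * S"

end

theory Submission
  imports Defs
begin

text \<open>
  Put \<open>t = 1 - 1/p\<close> and \<open>R = 2 + sqrt t\<close>. Let \<open>rad k x\<close> be the least radius at which the closed ball
  around \<open>x\<close> has mass at least \<open>R powr (- p k)\<close>; then \<open>\<Sum>k. R ^ k * rad k x\<close> is at most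
  \<open>C = S R / (R - 1)\<close>. For bounded continuous \<open>f\<close> with mean \<open>c\<close>, replacing a point by a random point
  of its \<open>j\<close>-th ball, then by one of that point's \<open>(j-1)\<close>-st ball, and so on, bounds \<open>\<bar>f x - c\<bar>\<close> by
  averaged oscillations of \<open>f\<close> on the balls met on the way. The oscillation at a pair \<open>(u, v)\<close> is at
  most \<open>rad k u\<close> times the difference quotient, which Young's inequality with parameter \<open>\<theta> R ^ k\<close> splits
  into a constant and a \<open>p\<close>-th power. The constants sum to a multiple of \<open>C\<close> because \<open>rad k\<close> is
  1-Lipschitz, so a chain started at \<open>x\<close> sees radii comparable with those at \<open>x\<close>. For the powers, the
  law of the \<open>k\<close>-th point of the chain has \<open>m\<close>-density at most \<open>R powr (p (k + 1))\<close>; so they are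
  controlled by the integral over a measure that does not depend on \<open>x\<close> and has mass at most \<open>C\<close>.
  Optimising \<open>\<theta>\<close> gives the constant; unbounded \<open>f\<close> are truncated.
\<close>

section \<open>Separability and the Borel sets of the product\<close>

text \<open>The boxes of radius \<open>1 / Suc n\<close> with centres in \<open>A\<close> form a
  countable base of the product, so open sets are countable unions of boxes. This is what lets a
  density over \<open>m \<Otimes>\<^sub>M m\<close> be a Borel measure on the product space.\<close>

lemma sets_borel_prod_separable:
  fixes A :: "'a::metric_space set"
  assumes "countable A" and dense: "\<And>x e. 0 < e \<Longrightarrow> \<exists>a\<in>A. dist x a < e"
  shows "sets ((borel :: 'a measure) \<Otimes>\<^sub>M (borel :: 'a measure)) = sets (borel :: ('a \<times> 'a) measure)"
proof (rule antisym)
  have f: "fst \<in> borel_measurable (borel :: ('a \<times> 'a) measure)"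
    and s: "snd \<in> borel_measurable (borel :: ('a \<times> 'a) measure)"
    by (intro borel_measurable_continuous_onI continuous_intros)+
  have "(\<lambda>x. x) \<in> (borel :: ('a \<times> 'a) measure) \<rightarrow>\<^sub>M (borel :: 'a measure) \<Otimes>\<^sub>M (borel :: 'a measure)"
    using measurable_Pair[OF f s] by simp
  from measurable_sets[OF this]
  show "sets ((borel :: 'a measure) \<Otimes>\<^sub>M (borel :: 'a measure)) \<subseteq> sets (borel :: ('a \<times> 'a) measure)"
    by auto
  have "W \<in> sets ((borel :: 'a measure) \<Otimes>\<^sub>M (borel :: 'a measure))"
    if W: "open W" for W :: "('a \<times> 'a) set"
  proof -
    define P where "P = {(a, b, n :: nat). a \<in> A \<and> b \<in> A \<and>
      ball a (1 / Suc n) \<times> ball b (1 / Suc n) \<subseteq> W}"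
    have "P \<subseteq> A \<times> A \<times> UNIV" by (auto simp: P_def)
    then have cP: "countable P"
      by (rule countable_subset) (use assms(1) in auto)
    have "W = (\<Union>(a, b, n)\<in>P. ball a (1 / Suc n) \<times> ball b (1 / Suc n))" (is "_ = ?U")
    proof
      show "W \<subseteq> ?U"
      proof
        fix z assume z: "z \<in> W"
        obtain x y where xy: "z = (x, y)" by (cases z)
        obtain U V where UV: "open U" "open V" "x \<in> U" "y \<in> V" "U \<times> V \<subseteq> W"
          using open_prod_elim[OF W z] xy by (metis mem_Sigma_iff)
        obtain e1 where e1: "e1 > 0" "ball x e1 \<subseteq> U" using UV open_contains_ball by blast
        obtain e2 where e2: "e2 > 0" "ball y e2 \<subseteq> V" using UV open_contains_ball by blast
        \<comment> \<open>Half of the smaller radius: a ball of this radius whose centre is this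
          close to \<open>x\<close> (or \<open>y\<close>) stays inside the larger ball.\<close>
        obtain n :: nat where n: "1 / Suc n < min e1 e2 / 2"
          using nat_approx_posE[of "min e1 e2 / 2"] e1 e2 by auto
        obtain a where a: "a \<in> A" "dist x a < 1 / Suc n" using dense[of "1 / Suc n" x] by auto
        obtain b where b: "b \<in> A" "dist y b < 1 / Suc n" using dense[of "1 / Suc n" y] by auto
        have n1: "1 / Suc n < e1 / 2" and n2: "1 / Suc n < e2 / 2" using n by linarith+
        have sub1: "ball a (1 / Suc n) \<subseteq> U"
        proof
          fix w assume "w \<in> ball a (1 / Suc n)"
          then have "dist x w < e1"
            using dist_triangle[of x w a] a n1 unfolding mem_ball by linarith
          then show "w \<in> U" using e1 by auto
        qed
        have sub2: "ball b (1 / Suc n) \<subseteq> V"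
        proof
          fix w assume "w \<in> ball b (1 / Suc n)"
          then have "dist y w < e2"
            using dist_triangle[of y w b] b n2 unfolding mem_ball by linarith
          then show "w \<in> V" using e2 by auto
        qed
        have "(a, b, n) \<in> P" using a b sub1 sub2 UV unfolding P_def by blast
        moreover have "z \<in> ball a (1 / Suc n) \<times> ball b (1 / Suc n)"
          using a b xy by (auto simp: dist_commute)
        ultimately show "z \<in> ?U" by blast
      qed
    qed (auto simp: P_def)
    also have "\<dots> \<in> sets ((borel :: 'a measure) \<Otimes>\<^sub>M (borel :: 'a measure))"
      by (intro sets.countable_UN' cP) auto
    finally show ?thesis .
  qed
  then show "sets (borel :: ('a \<times> 'a) measure) \<subseteq> sets ((borel :: 'a measure) \<Otimes>\<^sub>M (borel :: 'a measure))"
    using sets.sigma_sets_subset[of "Collect open" "(borel :: 'a measure) \<Otimes>\<^sub>M (borel :: 'a measure)"]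
    by (auto simp: space_pair_measure borel_def[where 'a = "'a \<times> 'a"])
qed

text \<open>The \<open>e/3\<close>-balls around an \<open>e\<close>-separated set are disjoint and
  have mass at least \<open>c\<close> each, so such a set has at most \<open>1 / c\<close> points. A
  largest one is a finite \<open>e\<close>-net, and the nets for \<open>e = 1 / Suc n\<close>
  together are countable and dense.\<close>

lemma separable_if_ball_measure_bounded_below:
  fixes M :: "'a::metric_space measure"
  assumes "prob_space M" and sets: "sets M = sets borel"
    and lower: "\<And>e. 0 < e \<Longrightarrow> \<exists>c>0. \<forall>x. c \<le> measure M (cball x e)"
  obtains A :: "'a set" where "countable A" "\<And>x e. 0 < e \<Longrightarrow> \<exists>a\<in>A. dist x a < e"
proof -
  interpret prob_space M by fact
  have net: "\<exists>F :: 'a set. finite F \<and> (\<forall>x. \<exists>a\<in>F. dist x a < e)" if e: "0 < e" for e :: real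
  proof -
    obtain c where c: "0 < c" "\<And>x. c \<le> measure M (cball x (e/3))" using lower[of "e/3"] e by auto
    define Sep where "Sep = {F :: 'a set. finite F \<and> (\<forall>x\<in>F. \<forall>y\<in>F. x \<noteq> y \<longrightarrow> e \<le> dist x y)}"
    have bound: "card F \<le> nat \<lfloor>1 / c\<rfloor>" if F: "F \<in> Sep" for F
    proof -
      have disj: "disjoint_family_on (\<lambda>x. cball x (e/3)) F"
        unfolding disjoint_family_on_def
      proof (intro ballI impI)
        fix x y assume "x \<in> F" "y \<in> F" "x \<noteq> y"
        then have d: "e \<le> dist x y" using F by (auto simp: Sep_def)
        show "cball x (e/3) \<inter> cball y (e/3) = {}"
        proof (rule ccontr)
          assume "cball x (e/3) \<inter> cball y (e/3) \<noteq> {}"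
          then obtain z where "dist x z \<le> e/3" "dist y z \<le> e/3" by auto
          then show False using d e dist_triangle2[of x y z] by linarith
        qed
      qed
      have "real (card F) * c = (\<Sum>x\<in>F. c)" by simp
      also have "\<dots> \<le> (\<Sum>x\<in>F. measure M (cball x (e/3)))" by (intro sum_mono c)
      also have "\<dots> = measure M (\<Union>x\<in>F. cball x (e/3))"
        by (intro finite_measure_finite_Union[symmetric] disj) (use F in \<open>auto simp: Sep_def sets\<close>)
      also have "\<dots> \<le> 1" by (rule prob_le_1)
      finally have "real (card F) \<le> 1 / c" using c by (simp add: field_simps)
      then show ?thesis by linarith
    qed
    have ne: "{} \<in> Sep" by (simp add: Sep_def)
    \<comment> \<open>A separated set of greatest cardinality exists because cardinalities in
      \<open>Sep\<close> are bounded; a point at distance at least \<open>e\<close> from all of it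
      could still be added.\<close>
    obtain F where F: "F \<in> Sep" "\<And>G. G \<in> Sep \<Longrightarrow> card G \<le> card F"
      using ex_has_greatest_nat[of "\<lambda>F. F \<in> Sep" "{}" card "Suc (nat \<lfloor>1 / c\<rfloor>)"] ne bound
      by (auto simp: less_Suc_eq_le)
    have "\<exists>a\<in>F. dist x a < e" for x
    proof (rule ccontr)
      assume *: "\<not> (\<exists>a\<in>F. dist x a < e)"
      then have "x \<notin> F" using e by auto
      moreover have "insert x F \<in> Sep" using F * by (auto simp: Sep_def dist_commute not_less)
      ultimately show False using F(2)[of "insert x F"] F(1) by (auto simp: Sep_def)
    qed
    then show ?thesis using F(1) by (auto simp: Sep_def)
  qed
  have "\<exists>F :: nat \<Rightarrow> 'a set. \<forall>n. finite (F n) \<and> (\<forall>x. \<exists>a\<in>F n. dist x a < 1 / Suc n)"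
    by (intro choice allI net) simp
  then obtain F :: "nat \<Rightarrow> 'a set" where F: "\<And>n. finite (F n)"
    "\<And>n x. \<exists>a\<in>F n. dist x a < 1 / Suc n" by blast
  show ?thesis
  proof (rule that)
    show "countable (\<Union>n. F n)" using F by (auto intro: countable_finite)
    fix x :: 'a and e :: real assume "0 < e"
    then obtain n where "1 / Suc n < e" using nat_approx_posE by blast
    moreover obtain a where "a \<in> F n" "dist x a < 1 / Suc n" using F(2) by blast
    ultimately show "\<exists>a\<in>\<Union>n. F n. dist x a < e" by (intro bexI[of _ a]) auto
  qed
qed

section \<open>Young's inequality and the numerical constant\<close>

text \<open>Bernoulli's inequality for exponents in the unit interval, as weighted AM-GM for
  \<open>x\<close> and \<open>1\<close>.\<close>

lemma powr_le_linear:
  fixes x a :: real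
  assumes "0 < x" "0 \<le> a" "a \<le> 1"
  shows "x powr a \<le> 1 + a * (x - 1)"
proof -
  have "x powr a * 1 powr (1 - a) \<le> a * x + (1 - a) * 1"
    by (rule Youngs_inequality_0) (use assms in auto)
  then show ?thesis by (simp add: algebra_simps)
qed

text \<open>Young's inequality for the product of \<open>g\<close> and
  \<open>\<tau> powr (p - 1)\<close>, divided by the latter. Writing \<open>1 - 1/p\<close> instead
  of \<open>1 / q\<close> keeps \<open>p = 1\<close> included.\<close>

lemma powr_young:
  fixes g \<tau> p :: real
  assumes "1 \<le> p" "0 < \<tau>" "0 \<le> g"
  shows "g \<le> (1 - 1/p) * \<tau> + (1/p) * \<tau> powr (1 - p) * g powr p"
proof (cases "g = 0")
  case False
  have "(g powr p) powr (1/p) * (\<tau> powr p) powr (1 - 1/p) \<le> (1/p) * g powr p + (1 - 1/p) * \<tau> powr p"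
    by (rule Youngs_inequality_0) (use assms False in auto)
  moreover have "(g powr p) powr (1/p) = g" "(\<tau> powr p) powr (1 - 1/p) = \<tau> powr (p - 1)"
    using assms False by (auto simp: powr_powr algebra_simps)
  ultimately have "g * \<tau> powr (p - 1) \<le> (1/p) * g powr p + (1 - 1/p) * \<tau> powr p" by simp
  then have "(g * \<tau> powr (p - 1)) * \<tau> powr (1 - p) \<le>
      ((1/p) * g powr p + (1 - 1/p) * \<tau> powr p) * \<tau> powr (1 - p)"
    by (rule mult_right_mono) simp
  moreover have "\<tau> powr (p - 1) * \<tau> powr (1 - p) = 1" "\<tau> powr p * \<tau> powr (1 - p) = \<tau>"
    using assms by (auto simp flip: powr_add)
  ultimately show ?thesis by (simp add: algebra_simps)
qed (use assms in auto)

lemma optimize_young: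
  fixes y a b p :: real
  assumes p: "1 \<le> p" and a: "0 < a" and b: "0 \<le> b"
    and le: "\<And>\<theta>. 0 < \<theta> \<Longrightarrow> y \<le> (1 - 1/p) * \<theta> * a + (1/p) * \<theta> powr (1 - p) * b"
  shows "y \<le> a powr (1 - 1/p) * b powr (1/p)"
proof (cases "b = 0")
  case True
  \<comment> \<open>For \<open>b = 0\<close> there is no minimising \<theta>; the bound follows by
    letting \<theta> tend to 0 as \<open>e / a\<close>.\<close>
  have "y \<le> 0 + e" if "0 < e" for e
  proof -
    have "y \<le> (1 - 1/p) * (e / a) * a" using le[of "e/a"] a that True by simp
    also have "\<dots> = (1 - 1/p) * e" using a by simp
    also have "\<dots> \<le> 1 * e" using p that by (intro mult_right_mono) auto
    finally show ?thesis by simp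
  qed
  then have "y \<le> 0" by (rule field_le_epsilon)
  with True show ?thesis by simp
next
  case False
  with b have b: "0 < b" by simp
  \<comment> \<open>This \<theta> makes \<open>\<theta> * a\<close> and
    \<open>\<theta> powr (1 - p) * b\<close> equal, and the weights \<open>1 - 1/p\<close> and
    \<open>1/p\<close> sum to 1.\<close>
  define \<theta> where "\<theta> = (b / a) powr (1/p)"
  have "y \<le> (1 - 1/p) * \<theta> * a + (1/p) * \<theta> powr (1 - p) * b"
    using a b by (intro le) (simp add: \<theta>_def)
  also have "\<dots> = (1 - 1/p) * (\<theta> * a) + (1/p) * (\<theta> powr (1 - p) * b)" by simp
  also have "\<theta> * a = a powr (1 - 1/p) * b powr (1/p)"
    using a b by (simp add: \<theta>_def powr_divide powr_diff field_simps)
  also have "\<theta> powr (1 - p) * b = a powr (1 - 1/p) * b powr (1/p)"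
  proof -
    have "\<theta> powr (1 - p) = (b / a) powr (1/p - 1)" using p by (simp add: \<theta>_def powr_powr diff_divide_distrib)
    then show ?thesis using a b by (simp add: powr_divide powr_diff field_simps)
  qed
  finally show ?thesis by (simp add: algebra_simps)
qed

text \<open>What remains of the comparison with \<open>K_const\<close> once common factors are
  cancelled, with \<open>s\<close> in the role of \<open>sqrt (1 - 1/p)\<close>. Linearising the
  power by Bernoulli leaves a polynomial inequality.\<close>

lemma chaining_constant_poly_powr_ineq:
  fixes s :: real
  assumes "0 < s" "s \<le> 1"
  shows "(2 + s)\<^sup>2 * (1 + s) powr (s\<^sup>2) \<le> 2 * (1 + s) * (2 + s\<^sup>2) * (2 + s\<^sup>2) powr (s\<^sup>2 / 2)"
proof -
  \<comment> \<open>The ratio that turns \<open>((1 + s)\<^sup>2) powr (s\<^sup>2 / 2)\<close> into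
    the matching power of \<open>2 + s\<^sup>2\<close>; the exponent is at most 1, as Bernoulli
    requires.\<close>
  define x where "x = (1 + s)\<^sup>2 / (2 + s\<^sup>2)"
  have d: "0 < 2 + s\<^sup>2" by (simp add: add_pos_nonneg)
  have x: "0 < x" using assms d by (simp add: x_def)
  have s2: "s\<^sup>2 \<le> 1" using assms by (simp add: power_le_one)
  have "(1 + s) powr (s\<^sup>2) = ((1 + s)\<^sup>2) powr (s\<^sup>2 / 2)"
    using assms by (simp add: powr_powr flip: powr_numeral)
  also have "\<dots> = x powr (s\<^sup>2 / 2) * (2 + s\<^sup>2) powr (s\<^sup>2 / 2)"
    using assms d x by (simp add: x_def powr_mult[symmetric])
  finally have eq: "(1 + s) powr (s\<^sup>2) = x powr (s\<^sup>2 / 2) * (2 + s\<^sup>2) powr (s\<^sup>2 / 2)" .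
  have xm: "x - 1 = (2 * s - 1) / (2 + s\<^sup>2)"
    using d by (simp add: x_def field_simps power2_eq_square)
  have "x powr (s\<^sup>2 / 2) \<le> 1 + s\<^sup>2 / 2 * (x - 1)"
    using x s2 by (intro powr_le_linear) auto
  also have "\<dots> = (4 + 2 * s\<^sup>2 + s\<^sup>2 * (2 * s - 1)) / (2 * (2 + s\<^sup>2))"
    unfolding xm using d by (simp add: field_simps)
  finally have "(2 + s)\<^sup>2 * x powr (s\<^sup>2 / 2) \<le>
      (2 + s)\<^sup>2 * ((4 + 2 * s\<^sup>2 + s\<^sup>2 * (2 * s - 1)) / (2 * (2 + s\<^sup>2)))"
    by (rule mult_left_mono) simp
  also have "\<dots> \<le> 2 * (1 + s) * (2 + s\<^sup>2)"
  proof -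
    \<comment> \<open>The gap factorises, and its cubic factor is nonnegative because
      \<open>5 * s\<^sup>2 \<le> 5 < 8\<close>.\<close>
    have "4 * (1 + s) * (2 + s\<^sup>2)\<^sup>2 - (2 + s)\<^sup>2 * (4 + 2 * s\<^sup>2 + s\<^sup>2 * (2 * s - 1)) =
        s\<^sup>2 * (8 + 4 * s - 5 * s\<^sup>2 + 2 * s ^ 3)"
      by (simp add: algebra_simps power2_eq_square power3_eq_cube)
    moreover have "0 \<le> s\<^sup>2 * (8 + 4 * s - 5 * s\<^sup>2 + 2 * s ^ 3)"
      using s2 assms by (intro mult_nonneg_nonneg add_nonneg_nonneg) auto
    ultimately have "(2 + s)\<^sup>2 * (4 + 2 * s\<^sup>2 + s\<^sup>2 * (2 * s - 1)) \<le>
        (2 * (1 + s) * (2 + s\<^sup>2)) * (2 * (2 + s\<^sup>2))"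
      by (simp add: power2_eq_square power3_eq_cube algebra_simps)
    then show ?thesis using d by (simp add: pos_divide_le_eq)
  qed
  finally have "(2 + s)\<^sup>2 * x powr (s\<^sup>2 / 2) * (2 + s\<^sup>2) powr (s\<^sup>2 / 2) \<le>
      2 * (1 + s) * (2 + s\<^sup>2) * (2 + s\<^sup>2) powr (s\<^sup>2 / 2)"
    by (rule mult_right_mono) simp
  then show ?thesis unfolding eq by (simp add: mult.assoc)
qed

text \<open>The left side is what optimising \<theta> yields for \<open>R = 2 + s\<close> and
  \<open>C = S * R / (R - 1)\<close>: the bases are \<open>(R - 1) / (R - 2) * C\<close> and
  \<open>R powr p * C\<close>.\<close>

lemma chaining_constant_le_K_const:
  fixes p S s :: real
  assumes p: "1 < p" and S: "0 < S" and s_def: "s = sqrt (1 - 1/p)"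
  shows "(S * (2 + s) / s) powr (1 - 1/p) * ((2 + s) powr p * (S * (2 + s) / (1 + s))) powr (1/p)
    \<le> K_const p S"
proof -
  \<comment> \<open>\<open>t\<close> is \<open>1 / q\<close>, so that \<open>(3 * p - 1) / p\<close>
    is \<open>2 + t\<close> and \<open>3 * q - q / p\<close> is \<open>(2 + t) / t\<close>.\<close>
  define t where "t = 1 - 1/p"
  have t: "0 < t" "t < 1" using p by (auto simp: t_def)
  have s: "0 < s" "s \<le> 1" "s\<^sup>2 = t" using t by (auto simp: s_def t_def)
  have pt: "1/p = 1 - t" by (simp add: t_def)
  have "(S * (2 + s) / s) powr t * ((2 + s) powr p * (S * (2 + s) / (1 + s))) powr (1/p)
      = (S powr t * S powr (1 - t)) * ((2 + s) * ((2 + s) powr t * (2 + s) powr (1 - t))) *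
        s powr (-t) * (1 + s) powr (t - 1)"
  proof -
    have "((2 + s) powr p) powr (1/p) = 2 + s" using p s by (simp add: powr_powr)
    then have "((2 + s) powr p * (S * (2 + s) / (1 + s))) powr (1/p) =
        (2 + s) * ((S * (2 + s)) powr (1 - t) / (1 + s) powr (1 - t))"
      using s S by (simp add: powr_mult powr_divide pt)
    moreover have "(1 + s) powr (t - 1) = 1 / (1 + s) powr (1 - t)"
      by (metis minus_diff_eq powr_minus_divide)
    ultimately show ?thesis using s S
      by (simp add: powr_mult powr_divide powr_minus_divide)
  qed
  also have "\<dots> = S * (2 + s)\<^sup>2 * s powr (-t) * (1 + s) powr (t - 1)"
    using S s by (simp flip: powr_add add: power2_eq_square)
  also have "\<dots> = S * s powr (-t) / (1 + s) * ((2 + s)\<^sup>2 * (1 + s) powr (s\<^sup>2))"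
    using s by (simp add: powr_diff)
  also have "\<dots> \<le> S * s powr (-t) / (1 + s) * (2 * (1 + s) * (2 + s\<^sup>2) * (2 + s\<^sup>2) powr (s\<^sup>2 / 2))"
    using s S by (intro mult_left_mono chaining_constant_poly_powr_ineq) auto
  also have "\<dots> = S * (2 * (2 + t) * ((2 + t) powr (t/2) * s powr (-t)))"
    using s by (simp add: field_simps)
  also have "s powr (-t) = t powr (-t/2)"
    using s t by (simp add: powr_powr flip: s(3) powr_numeral)
  also have "(2 + t) powr (t/2) * t powr (-t/2) = ((2 + t) / t) powr (t/2)"
    using t by (simp add: powr_divide powr_minus_divide)
  also have "\<dots> = K_factor p"
  proof -
    have q: "p / (p - 1) = 1 / t" using p by (simp add: t_def field_simps)
    have "3 * (1 / t) - 1 / t / p = (3 - 1/p) / t" using t by (simp add: field_simps)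
    then have eqs: "3 * (p / (p - 1)) - p / (p - 1) / p = (2 + t) / t" "1 / (2 * (p / (p - 1))) = t / 2"
      unfolding q pt by simp_all
    show ?thesis unfolding K_factor_def Let_def eqs using p by simp
  qed
  also have "S * (2 * (2 + t) * K_factor p) = K_const p S"
    using p by (simp add: K_const_def t_def field_simps)
  finally show ?thesis by (simp add: t_def)
qed

section \<open>Radii at which balls reach geometric mass thresholds\<close>

locale majorizing_chain = prob_space m for m :: "'a::metric_space measure" +
  fixes p R D :: real
  assumes sets_m: "sets m = sets borel"
    and p: "1 \<le> p" and R: "2 \<le> R"
    and diam: "\<And>x y :: 'a. dist x y \<le> D"
begin

lemma R_pos [simp]: "0 < R" and R_gt1: "1 < R"
  using R by auto

lemma space_m: "space m = UNIV"
  using sets_eq_imp_space_eq[OF sets_m] by simp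

lemma D_nonneg: "0 \<le> D"
  using diam[of undefined undefined] by simp

lemma measure_mono_cball: "e \<le> e' \<Longrightarrow> measure m (cball x e) \<le> measure m (cball x e')"
  by (rule finite_measure_mono) (auto simp: sets_m)

text \<open>Chosen so that \<open>(1 / thr k) powr (1/p) = R ^ k\<close>: where a ball has mass
  below \<open>thr k\<close>, the entropy integrand exceeds \<open>R ^ k\<close>. Level 0 asks for
  full mass.\<close>

definition thr :: "nat \<Rightarrow> real" where
  "thr k = R powr (- p * real k)"

lemma thr_pos: "0 < thr k" and thr_le_1: "thr k \<le> 1"
  using R p powr_mono[of "- p * real k" 0 R] by (auto simp: thr_def)

definition rad :: "nat \<Rightarrow> 'a \<Rightarrow> real" where
  "rad k x = Inf {e. 0 \<le> e \<and> thr k \<le> measure m (cball x e)}"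

lemma cball_D: "cball (x::'a) D = UNIV"
  using diam by auto

lemma D_mem: "D \<in> {e. 0 \<le> e \<and> thr k \<le> measure m (cball x e)}"
  using thr_le_1 D_nonneg prob_space by (simp add: cball_D space_m)

lemma rad_bdd: "bdd_below {e. 0 \<le> e \<and> thr k \<le> measure m (cball x e)}"
  by (rule bdd_belowI[of _ 0]) auto

lemma rad_nonneg [simp]: "0 \<le> rad k x"
  unfolding rad_def by (rule cInf_greatest) (use D_mem in auto)

lemma rad_le: "0 \<le> e \<Longrightarrow> thr k \<le> measure m (cball x e) \<Longrightarrow> rad k x \<le> e"
  unfolding rad_def by (rule cInf_lower[OF _ rad_bdd]) auto

lemma rad_le_D: "rad k x \<le> D"
  using D_mem by (intro rad_le) auto

lemma thr_le_measure:
  assumes "rad k x < e" shows "thr k \<le> measure m (cball x e)"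
proof -
  obtain e' where "e' < e" "thr k \<le> measure m (cball x e')"
    using assms cInf_lessD[of "{e. 0 \<le> e \<and> thr k \<le> measure m (cball x e)}" e] D_mem
    unfolding rad_def by auto
  then show ?thesis using measure_mono_cball[of e' e x] by linarith
qed

text \<open>The infimum is attained: the closed ball is the decreasing intersection of slightly
  larger ones, and a finite measure is continuous from above.\<close>

lemma thr_le_measure_rad: "thr k \<le> measure m (cball x (rad k x))"
proof -
  define B where "B n = cball x (rad k x + 1 / Suc n)" for n :: nat
  have "(\<Inter>n. B n) = cball x (rad k x)"
  proof (intro set_eqI iffI)
    fix y assume y: "y \<in> (\<Inter>n. B n)"
    have "dist x y \<le> rad k x + e" if "0 < e" for e
    proof -
      obtain n :: nat where "1 / Suc n < e" using nat_approx_posE[of e] \<open>0 < e\<close> by blast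
      moreover have "dist x y \<le> rad k x + 1 / Suc n" using y by (auto simp: B_def)
      ultimately show ?thesis by linarith
    qed
    then show "y \<in> cball x (rad k x)" by (auto intro: field_le_epsilon)
  next
    fix y assume "y \<in> cball x (rad k x)"
    then show "y \<in> (\<Inter>n. B n)" by (auto simp: B_def intro: order_trans)
  qed
  moreover have "(\<lambda>n. measure m (B n)) \<longlonglongrightarrow> measure m (\<Inter>n. B n)"
  proof (rule finite_Lim_measure_decseq)
    show "range B \<subseteq> sets m" by (auto simp: B_def sets_m)
    show "decseq B" unfolding B_def decseq_def by (auto intro!: subset_cball divide_left_mono)
  qed
  moreover have "thr k \<le> measure m (B n)" for n
    unfolding B_def by (rule thr_le_measure) simp
  ultimately show ?thesis by (auto intro: LIMSEQ_le_const)
qed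

text \<open>The ball around \<open>u\<close> enlarged by \<open>dist u x\<close> contains the ball
  around \<open>x\<close>, hence has enough mass.\<close>

lemma rad_lipschitz: "rad k u \<le> rad k x + dist u x"
proof (rule rad_le)
  have "cball x (rad k x) \<subseteq> cball u (rad k x + dist u x)"
  proof
    fix y assume "y \<in> cball x (rad k x)"
    then show "y \<in> cball u (rad k x + dist u x)"
      using dist_triangle[of u y x] unfolding mem_cball by linarith
  qed
  then have "measure m (cball x (rad k x)) \<le> measure m (cball u (rad k x + dist u x))"
    by (rule finite_measure_mono) (auto simp: sets_m)
  then show "thr k \<le> measure m (cball u (rad k x + dist u x))"
    using thr_le_measure_rad[of k x] by linarith
qed simp

lemma measure_less_thr: "0 \<le> e \<Longrightarrow> e < rad k x \<Longrightarrow> measure m (cball x e) < thr k"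
  using rad_le[of e k x] by force

lemma continuous_rad: "continuous_on UNIV (rad k)"
proof (rule lipschitz_on_continuous_on[of 1])
  show "1-lipschitz_on UNIV (rad k)"
  proof (rule lipschitz_onI)
    fix x y show "dist (rad k x) (rad k y) \<le> 1 * dist x y"
      using rad_lipschitz[of k x y] rad_lipschitz[of k y x] by (auto simp: dist_real_def dist_commute abs_le_iff)
  qed simp
qed

text \<open>A layer-cake argument: the step function of \<open>e\<close> that gains
  \<open>(1 - 1/R) * R ^ k\<close> on \<open>{0<..<rad k x}\<close> has the left side as its
  integral and lies below the entropy integrand.\<close>

lemma sum_rad_le_integral:
  assumes pos: "\<And>e. 0 < e \<Longrightarrow> 0 < measure m (cball x e)"
    and diam_le: "ennreal D \<le> ediameter (UNIV :: 'a set)"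
  shows "ennreal ((1 - 1/R) * (\<Sum>k<N. R ^ k * rad k x)) \<le> majorizing_integral m p x"
proof -
  have pw: "(\<Sum>k<N. (1 - 1/R) * R ^ k * indicat_real {0<..<rad k x} e) \<le>
      (1 / measure m (cball x e)) powr (1/p)" if e: "0 < e" for e
  proof (cases "\<exists>k<N. e < rad k x")
    case True
    \<comment> \<open>The last level whose radius exceeds \<open>e\<close>. All active weights have
      index at most \<open>K\<close>, their geometric sum is at most \<open>R ^ K\<close>, and
      \<open>e < rad K x\<close> means mass below \<open>thr K\<close>.\<close>
    define K where "K = Max {k. k < N \<and> e < rad k x}"
    have K: "K \<in> {k. k < N \<and> e < rad k x}" unfolding K_def
      by (rule Max_in) (use True in auto)
    have upper: "k \<le> K" if "k < N" "e < rad k x" for k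
      unfolding K_def by (rule Max_ge) (use that in auto)
    have geo: "(\<Sum>k<n. (1 - 1/R) * R ^ k) \<le> R ^ n / R" for n
    proof (induction n)
      case (Suc n)
      then show ?case using R by (simp add: field_simps)
    qed (use R in simp)
    have "(\<Sum>k<N. (1 - 1/R) * R ^ k * indicat_real {0<..<rad k x} e) \<le> (\<Sum>k<Suc K. (1 - 1/R) * R ^ k)"
    proof -
      have "(\<Sum>k<N. (1 - 1/R) * R ^ k * indicat_real {0<..<rad k x} e) =
          (\<Sum>k\<in>{k\<in>{..<N}. e < rad k x}. (1 - 1/R) * R ^ k)"
        unfolding sum.inter_filter[OF finite_lessThan] using e by (intro sum.cong) auto
      also have "\<dots> \<le> (\<Sum>k<Suc K. (1 - 1/R) * R ^ k)"
        using upper R by (intro sum_mono2) (auto simp: less_Suc_eq_le)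
      finally show ?thesis .
    qed
    also have "\<dots> \<le> R ^ K" using geo[of "Suc K"] R by simp
    also have "R ^ K \<le> (1 / measure m (cball x e)) powr (1/p)"
    proof -
      have "1 / thr K \<le> 1 / measure m (cball x e)"
        using measure_less_thr[of e K x] K e pos[OF e] by (intro divide_left_mono) auto
      then have "(1 / thr K) powr (1/p) \<le> (1 / measure m (cball x e)) powr (1/p)"
        using p thr_pos[of K] by (intro powr_mono2) auto
      moreover have "(1 / thr K) powr (1/p) = R ^ K"
        using p R by (simp add: thr_def powr_minus_divide powr_powr powr_divide powr_realpow)
      ultimately show ?thesis by simp
    qed
    finally show ?thesis .
  next
    case False
    then have "(\<Sum>k<N. (1 - 1/R) * R ^ k * indicat_real {0<..<rad k x} e) = 0"
      by (intro sum.neutral) auto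
    then show ?thesis by simp
  qed
  let ?A = "{\<epsilon>. 0 < \<epsilon> \<and> ennreal \<epsilon> \<le> ediameter (UNIV :: 'a set)}"
  have "ennreal ((1 - 1/R) * (\<Sum>k<N. R ^ k * rad k x)) = (\<Sum>k<N. ennreal ((1 - 1/R) * R ^ k) * emeasure lborel {0<..<rad k x})"
  proof -
    have "(\<Sum>k<N. ennreal ((1 - 1/R) * R ^ k) * emeasure lborel {0<..<rad k x}) =
        (\<Sum>k<N. ennreal ((1 - 1/R) * R ^ k * rad k x))"
      using R by (intro sum.cong refl) (simp add: ennreal_mult)
    also have "\<dots> = ennreal (\<Sum>k<N. (1 - 1/R) * R ^ k * rad k x)"
      using R by (intro sum_ennreal) simp
    finally show ?thesis by (simp add: sum_distrib_left mult.assoc)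
  qed
  also have "\<dots> = (\<Sum>k<N. \<integral>\<^sup>+e. ennreal ((1 - 1/R) * R ^ k) * indicator {0<..<rad k x} e \<partial>lborel)"
    by (simp add: nn_integral_cmult_indicator)
  also have "\<dots> = (\<integral>\<^sup>+e. (\<Sum>k<N. ennreal ((1 - 1/R) * R ^ k) * indicator {0<..<rad k x} e) \<partial>lborel)"
    by (rule nn_integral_sum[symmetric]) simp
  also have "\<dots> \<le> (\<integral>\<^sup>+e\<in>?A. ennreal ((1 / measure m (cball x e)) powr (1 / p)) \<partial>lborel)"
  proof (rule nn_integral_mono)
    fix e :: real
    show "(\<Sum>k<N. ennreal ((1 - 1/R) * R ^ k) * indicator {0<..<rad k x} e) \<le>
      ennreal ((1 / measure m (cball x e)) powr (1 / p)) * indicator ?A e"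
    proof (cases "0 < e \<and> e \<le> D")
      case True
      then have "ennreal e \<le> ediameter (UNIV :: 'a set)"
        using diam_le by (meson ennreal_leI order_trans)
      moreover have "(\<Sum>k<N. ennreal ((1 - 1/R) * R ^ k) * indicator {0<..<rad k x} e) =
          ennreal (\<Sum>k<N. (1 - 1/R) * R ^ k * indicat_real {0<..<rad k x} e)"
        using R by (subst sum_ennreal[symmetric]) (auto simp: indicator_def intro!: sum.cong)
      ultimately show ?thesis using True pw[of e] by (auto intro: ennreal_leI)
    next
      \<comment> \<open>Outside \<open>(0, D]\<close> every indicator vanishes, since no radius
        exceeds \<open>D\<close>.\<close>
      case False
      then have "e \<notin> {0<..<rad k x}" for k
        using rad_le_D[of k x] by auto
      then have "(\<Sum>k<N. ennreal ((1 - 1/R) * R ^ k) * indicator {0<..<rad k x} e) = 0"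
        by (intro sum.neutral) (simp add: indicator_def)
      then show ?thesis by simp
    qed
  qed
  finally show ?thesis unfolding majorizing_integral_def .
qed

end

section \<open>Uniform decay of the radii and measurability\<close>

locale bounded_majorizing_chain = majorizing_chain m p R D
    for m :: "'a::metric_space measure" and p R D +
  fixes C :: real
  assumes sum_rad: "\<And>x N. (\<Sum>k<N. R ^ k * rad k x) \<le> C"
begin

lemma C_nonneg: "0 \<le> C"
  using sum_rad[where N = 0] by simp

text \<open>A single term of the sum already gives \<open>R ^ k * rad k x \<le> C\<close>, uniformly
  in \<open>x\<close>.\<close>

lemma ex_rad_less:
  assumes "0 < e" shows "\<exists>k. \<forall>x. rad k x < e"
proof -
  obtain k where k: "C / e < R ^ k" using real_arch_pow[OF R_gt1] by blast
  have "rad k x < e" for x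
  proof -
    have "R ^ k * rad k x \<le> (\<Sum>i<Suc k. R ^ i * rad i x)"
      using R by (intro member_le_sum) auto
    also have "\<dots> < R ^ k * e" using sum_rad[of x "Suc k"] k assms by (simp add: field_simps)
    finally show ?thesis by simp
  qed
  then show ?thesis by blast
qed

text \<open>Once all \<open>rad k\<close> are below \<open>e\<close>, every \<open>e\<close>-ball
  has mass at least \<open>thr k\<close>; this uniform lower bound makes the space
  separable.\<close>

lemma sets_pair: "sets (m \<Otimes>\<^sub>M m) = sets (borel :: ('a \<times> 'a) measure)"
proof -
  have lower: "\<exists>c>0. \<forall>x. c \<le> measure m (cball x e)" if "0 < e" for e
    using ex_rad_less[OF that] thr_pos thr_le_measure by blast
  obtain A :: "'a set" where A: "countable A" "\<And>x e. 0 < e \<Longrightarrow> \<exists>a\<in>A. dist x a < e"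
    using separable_if_ball_measure_bounded_below[OF prob_space_axioms sets_m lower] by blast
  have "sets (m \<Otimes>\<^sub>M m) = sets ((borel :: 'a measure) \<Otimes>\<^sub>M (borel :: 'a measure))"
    by (intro sets_pair_measure_cong sets_m)
  also have "\<dots> = sets (borel :: ('a \<times> 'a) measure)"
    by (rule sets_borel_prod_separable[OF A])
  finally show ?thesis .
qed

lemma continuous_pair_measurable:
  fixes F :: "'a \<times> 'a \<Rightarrow> 'b::topological_space"
  assumes "continuous_on UNIV F" shows "F \<in> borel_measurable (m \<Otimes>\<^sub>M m)"
  using borel_measurable_continuous_onI[OF assms] measurable_cong_sets[OF sets_pair refl] by blast

lemma continuous_measurable:
  fixes F :: "'a \<Rightarrow> 'b::topological_space"
  assumes "continuous_on UNIV F" shows "F \<in> borel_measurable m"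
  using borel_measurable_continuous_onI[OF assms] measurable_cong_sets[OF sets_m refl] by blast

lemma rad_measurable [measurable]: "rad k \<in> borel_measurable m"
  by (rule continuous_measurable[OF continuous_rad])

section \<open>Random jumps: kernels, averages and chains\<close>

text \<open>The density with respect to \<open>m\<close> of the normalised restriction of
  \<open>m\<close> to the \<open>k\<close>-th ball around \<open>u\<close>.\<close>

definition ker :: "nat \<Rightarrow> 'a \<Rightarrow> 'a \<Rightarrow> real" where
  "ker k u v = indicat_real (cball u (rad k u)) v / measure m (cball u (rad k u))"

lemma measure_ball_pos: "0 < measure m (cball u (rad k u))"
  using thr_pos thr_le_measure_rad less_le_trans by blast

lemma ker_nonneg [simp]: "0 \<le> ker k u v"
  by (simp add: ker_def)

lemma ker_eq_0: "rad k u < dist u v \<Longrightarrow> ker k u v = 0"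
  by (simp add: ker_def)

lemma ker_le: "ker k u v \<le> R powr (p * real k)"
proof -
  have "ker k u v \<le> 1 / measure m (cball u (rad k u))"
    unfolding ker_def by (intro divide_right_mono) (auto simp: indicator_def)
  also have "\<dots> \<le> 1 / thr k"
    using thr_pos measure_ball_pos thr_le_measure_rad by (intro divide_left_mono) auto
  also have "\<dots> = R powr (p * real k)" by (simp add: thr_def powr_minus_divide)
  finally show ?thesis .
qed

lemma ker_measurable_pair [measurable]: "(\<lambda>(u, v). ker k u v) \<in> borel_measurable (m \<Otimes>\<^sub>M m)"
proof -
  \<comment> \<open>The balls are the sections of this closed set, so their mass depends measurably
    on the centre.\<close>
  define E where "E = {z :: 'a \<times> 'a. dist (fst z) (snd z) \<le> rad k (fst z)}"
  have "closed E" unfolding E_def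
    by (intro closed_Collect_le continuous_intros continuous_on_compose2[OF continuous_rad]) auto
  then have [measurable]: "E \<in> sets (m \<Otimes>\<^sub>M m)" unfolding sets_pair by simp
  have 1: "(\<lambda>u. emeasure m (Pair u -` E)) \<in> borel_measurable m"
    by (rule measurable_emeasure_Pair) simp
  have "Pair u -` E = cball u (rad k u)" for u by (auto simp: E_def)
  then have [measurable]: "(\<lambda>u. measure m (cball u (rad k u))) \<in> borel_measurable m"
    unfolding measure_def using 1 by simp
  have "(\<lambda>z. indicat_real E z / measure m (cball (fst z) (rad k (fst z)))) \<in> borel_measurable (m \<Otimes>\<^sub>M m)"
    by measurable
  moreover have "(\<lambda>z. indicat_real E z / measure m (cball (fst z) (rad k (fst z)))) = (\<lambda>(u, v). ker k u v)"
    by (auto simp: ker_def E_def indicator_def)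
  ultimately show ?thesis by simp
qed

lemma ker_measurable [measurable]: "ker k u \<in> borel_measurable m"
  using measurable_Pair2[OF ker_measurable_pair, of u] by (simp add: space_m)

lemma nn_integral_ker: "(\<integral>\<^sup>+v. ennreal (ker k u v) \<partial>m) = 1"
proof -
  let ?b = "cball u (rad k u)"
  have "(\<integral>\<^sup>+v. ennreal (ker k u v) \<partial>m) = (\<integral>\<^sup>+v. ennreal (1 / measure m ?b) * indicator ?b v \<partial>m)"
    by (intro nn_integral_cong) (auto simp: ker_def indicator_def)
  also have "\<dots> = ennreal (1 / measure m ?b) * emeasure m ?b"
    by (rule nn_integral_cmult_indicator) (simp add: sets_m)
  also have "\<dots> = 1"
    using measure_ball_pos[of u k] by (simp add: emeasure_eq_measure flip: ennreal_mult)
  finally show ?thesis .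
qed

definition avg :: "nat \<Rightarrow> ('a \<Rightarrow> ennreal) \<Rightarrow> 'a \<Rightarrow> ennreal" where
  "avg k g u = (\<integral>\<^sup>+v. ennreal (ker k u v) * g v \<partial>m)"

lemma avg_measurable [measurable]:
  assumes [measurable]: "g \<in> borel_measurable m"
  shows "avg k g \<in> borel_measurable m"
  unfolding avg_def[abs_def] by measurable

lemma avg_add: "g \<in> borel_measurable m \<Longrightarrow> h \<in> borel_measurable m \<Longrightarrow>
    avg k (\<lambda>v. g v + h v) u = avg k g u + avg k h u"
  unfolding avg_def distrib_left by (rule nn_integral_add) auto

lemma avg_cmult: "g \<in> borel_measurable m \<Longrightarrow> avg k (\<lambda>v. c * g v) u = c * avg k g u"
  unfolding avg_def by (subst nn_integral_cmult[symmetric]) (auto simp: mult_ac)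

lemma avg_mono: "(\<And>v. dist u v \<le> rad k u \<Longrightarrow> g v \<le> h v) \<Longrightarrow> avg k g u \<le> avg k h u"
  unfolding avg_def
  by (intro nn_integral_mono) (metis ker_eq_0 ennreal_0 linorder_not_le mult_left_mono mult_zero_left order_refl zero_le)

lemma avg_const: "avg k (\<lambda>_. c) u = c"
  unfolding avg_def by (simp add: nn_integral_multc nn_integral_ker)

lemma avg_le_const: "(\<And>v. dist u v \<le> rad k u \<Longrightarrow> g v \<le> c) \<Longrightarrow> avg k g u \<le> c"
  using avg_mono[of u k g "\<lambda>_. c"] by (simp add: avg_const)

lemma avg_le_integral:
  assumes "g \<in> borel_measurable m"
  shows "avg k g u \<le> ennreal (R powr (p * real k)) * (\<integral>\<^sup>+v. g v \<partial>m)"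
  unfolding avg_def nn_integral_cmult[OF assms, symmetric]
  by (intro nn_integral_mono mult_right_mono ennreal_leI ker_le) auto

text \<open>The expected total cost of the chain of random points started at level \<open>j\<close>, where \<open>h k u\<close> is
  the cost of being at \<open>u\<close> before the jump of level \<open>k\<close>.\<close>

primrec chain :: "(nat \<Rightarrow> 'a \<Rightarrow> ennreal) \<Rightarrow> nat \<Rightarrow> 'a \<Rightarrow> ennreal" where
  "chain h 0 = (\<lambda>u. 0)"
| "chain h (Suc j) = avg (Suc j) (\<lambda>v. h j v + chain h j v)"

lemma chain_measurable [measurable]:
  "(\<And>k. h k \<in> borel_measurable m) \<Longrightarrow> chain h j \<in> borel_measurable m"
  by (induction j) auto

lemma chain_mono: "(\<And>k u. h k u \<le> h' k u) \<Longrightarrow> chain h j u \<le> chain h' j u"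
  by (induction j arbitrary: u) (auto intro!: avg_mono add_mono)

lemma chain_add:
  assumes [measurable]: "\<And>k. h k \<in> borel_measurable m" "\<And>k. h' k \<in> borel_measurable m"
  shows "chain (\<lambda>k u. h k u + h' k u) j u = chain h j u + chain h' j u"
proof (induction j arbitrary: u)
  case (Suc j)
  have "chain (\<lambda>k u. h k u + h' k u) (Suc j) u =
      avg (Suc j) (\<lambda>v. (h j v + chain h j v) + (h' j v + chain h' j v)) u"
    by (simp add: Suc add_ac)
  also have "\<dots> = chain h (Suc j) u + chain h' (Suc j) u"
    by (subst avg_add) auto
  finally show ?case .
qed simp

lemma chain_cmult:
  assumes [measurable]: "\<And>k. h k \<in> borel_measurable m"
  shows "chain (\<lambda>k u. c * h k u) j u = c * chain h j u"
proof (induction j arbitrary: u)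
  case (Suc j)
  then show ?case by (simp add: avg_cmult flip: distrib_left)
qed simp

text \<open>Only the last jump matters for the density: the earlier averages preserve constants.\<close>

lemma chain_le_integral:
  assumes [measurable]: "\<And>k. h k \<in> borel_measurable m"
  shows "chain h j u \<le> (\<Sum>k<j. ennreal (R powr (p * real (Suc k))) * (\<integral>\<^sup>+v. h k v \<partial>m))"
proof (induction j arbitrary: u)
  case (Suc j)
  have "chain h (Suc j) u = avg (Suc j) (h j) u + avg (Suc j) (chain h j) u"
    by (simp add: avg_add)
  also have "\<dots> \<le> ennreal (R powr (p * real (Suc j))) * (\<integral>\<^sup>+v. h j v \<partial>m) +
      (\<Sum>k<j. ennreal (R powr (p * real (Suc k))) * (\<integral>\<^sup>+v. h k v \<partial>m))"
    by (intro add_mono avg_le_integral avg_le_const Suc) simp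
  finally show ?case by (simp add: add.commute)
qed simp

text \<open>A jump of level \<open>Suc j\<close> from \<open>u\<close> increases each radius by at
  most \<open>rad (Suc j) u\<close>. The extra term with \<open>R ^ j / (R - 2)\<close> makes the
  induction close: it absorbs these increments summed over all lower levels.\<close>

lemma chain_rad:
  assumes R2: "2 < R"
  shows "chain (\<lambda>k u. ennreal (R ^ k * rad k u)) j u \<le>
    ennreal ((R - 1) / (R - 2) * (\<Sum>i<j. R ^ i * rad i u) + R ^ j / (R - 2) * rad j u)"
proof (induction j arbitrary: u)
  case (Suc j)
  let ?\<kappa> = "(R - 1) / (R - 2)"
  have \<kappa>: "0 \<le> ?\<kappa>" using R2 by simp
  have geo: "?\<kappa> * (\<Sum>i<Suc j. R ^ i) \<le> R ^ Suc j / (R - 2)"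
  proof -
    have "(R - 1) * (\<Sum>i<Suc j. R ^ i) = R ^ Suc j - 1"
      using power_diff_1_eq[of R "Suc j"] by simp
    then have "?\<kappa> * (\<Sum>i<Suc j. R ^ i) = (R ^ Suc j - 1) / (R - 2)" by (metis times_divide_eq_left)
    also have "\<dots> \<le> R ^ Suc j / (R - 2)" using R2 by (intro divide_right_mono) auto
    finally show ?thesis .
  qed
  show ?case unfolding chain.simps
  proof (rule avg_le_const)
    fix v assume v: "dist u v \<le> rad (Suc j) u"
    have "ennreal (R ^ j * rad j v) + chain (\<lambda>k u. ennreal (R ^ k * rad k u)) j v \<le>
        ennreal (R ^ j * rad j v) + ennreal (?\<kappa> * (\<Sum>i<j. R ^ i * rad i v) + R ^ j / (R - 2) * rad j v)"
      by (intro add_left_mono Suc)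
    also have "\<dots> = ennreal (R ^ j * rad j v + (?\<kappa> * (\<Sum>i<j. R ^ i * rad i v) + R ^ j / (R - 2) * rad j v))"
      using R2 by (intro ennreal_plus[symmetric]) (auto intro!: add_nonneg_nonneg mult_nonneg_nonneg divide_nonneg_nonneg sum_nonneg)
    also have "R ^ j * rad j v + (?\<kappa> * (\<Sum>i<j. R ^ i * rad i v) + R ^ j / (R - 2) * rad j v) =
        ?\<kappa> * (\<Sum>i<Suc j. R ^ i * rad i v)"
    proof -
      \<comment> \<open>The cost at level \<open>j\<close> plus the extra term inherited from the
        induction hypothesis is exactly the next term of the sum weighted by
        \<open>?\<kappa>\<close>.\<close>
      have "1 + 1 / (R - 2) = ?\<kappa>" using R2 by (simp add: field_simps)
      then have "R ^ j * rad j v + R ^ j / (R - 2) * rad j v = ?\<kappa> * (R ^ j * rad j v)"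
        by (metis (no_types, opaque_lifting) distrib_right mult_1 times_divide_eq_left mult.commute)
      then show ?thesis by (simp add: distrib_left)
    qed
    also have "\<dots> \<le> ?\<kappa> * (\<Sum>i<Suc j. R ^ i * (rad i u + rad (Suc j) u))"
    proof (intro mult_left_mono sum_mono)
      fix i
      show "rad i v \<le> rad i u + rad (Suc j) u"
        using rad_lipschitz[of i v u] v by (simp add: dist_commute)
    qed (use \<kappa> R in auto)
    also have "\<dots> = ?\<kappa> * (\<Sum>i<Suc j. R ^ i * rad i u) + ?\<kappa> * (\<Sum>i<Suc j. R ^ i) * rad (Suc j) u"
      by (simp only: distrib_left sum.distrib sum_distrib_right mult.assoc)
    also have "\<dots> \<le> ?\<kappa> * (\<Sum>i<Suc j. R ^ i * rad i u) + R ^ Suc j / (R - 2) * rad (Suc j) u"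
      by (intro add_left_mono mult_right_mono geo) simp
    finally show "ennreal (R ^ j * rad j v) + chain (\<lambda>k u. ennreal (R ^ k * rad k u)) j v \<le>
        ennreal (?\<kappa> * (\<Sum>i<Suc j. R ^ i * rad i u) + R ^ Suc j / (R - 2) * rad (Suc j) u)"
      by (simp add: ennreal_leI)
  qed
qed simp

text \<open>Since \<open>1 \<le> R - 1\<close>, the extra term is at most one further term of the
  weighted sum, and \<open>sum_rad\<close> applies with \<open>Suc j\<close> terms.\<close>

lemma chain_rad_le:
  assumes R2: "2 < R"
  shows "chain (\<lambda>k u. ennreal (R ^ k * rad k u)) j u \<le> ennreal ((R - 1) / (R - 2) * C)"
proof -
  have "(R - 1) / (R - 2) * (\<Sum>i<j. R ^ i * rad i u) + R ^ j / (R - 2) * rad j u \<le>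
      (R - 1) / (R - 2) * (\<Sum>i<j. R ^ i * rad i u) + (R - 1) / (R - 2) * (R ^ j * rad j u)"
  proof (rule add_left_mono)
    have "1 * (R ^ j * rad j u / (R - 2)) \<le> (R - 1) * (R ^ j * rad j u / (R - 2))"
      using R2 by (intro mult_right_mono) auto
    then show "R ^ j / (R - 2) * rad j u \<le> (R - 1) / (R - 2) * (R ^ j * rad j u)" by simp
  qed
  also have "\<dots> = (R - 1) / (R - 2) * (\<Sum>i<Suc j. R ^ i * rad i u)" by (simp add: distrib_left)
  also have "\<dots> \<le> (R - 1) / (R - 2) * C" using R2 by (intro mult_left_mono sum_rad) auto
  finally show ?thesis using chain_rad[OF R2, of j u] by (meson ennreal_leI order_trans)
qed

section \<open>Deviation from the mean along a chain\<close>

definition osc :: "('a \<Rightarrow> real) \<Rightarrow> nat \<Rightarrow> 'a \<Rightarrow> ennreal" where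
  "osc f k u = avg k (\<lambda>v. ennreal \<bar>f u - f v\<bar>) u"

lemma osc_measurable [measurable]:
  assumes "continuous_on UNIV f"
  shows "osc f k \<in> borel_measurable m"
proof -
  have [measurable]: "f \<in> borel_measurable m" by (rule continuous_measurable[OF assms])
  show ?thesis unfolding osc_def[abs_def] avg_def by measurable
qed

text \<open>Induction on the starting level: average the triangle inequality through
  \<open>v\<close> over the ball around \<open>u\<close>, and apply the hypothesis at
  \<open>v\<close>. The chain ends at level 0 with a point distributed as \<open>m\<close>, which
  produces the mean.\<close>

lemma abs_diff_mean_le_chain:
  fixes f :: "'a \<Rightarrow> real"
  assumes f: "continuous_on UNIV f" and bdd: "\<And>x. \<bar>f x\<bar> \<le> B"
  shows "ennreal \<bar>f u - (\<integral>v. f v \<partial>m)\<bar> \<le> osc f j u + chain (osc f) j u"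
proof (induction j arbitrary: u)
  case 0
  have [measurable]: "f \<in> borel_measurable m" by (rule continuous_measurable[OF f])
  have int: "integrable m f"
    by (rule integrable_const_bound[of _ B]) (use bdd in auto)
  \<comment> \<open>As \<open>thr 0 = 1\<close>, the level-0 ball has full mass and its kernel is 1
    almost everywhere.\<close>
  have "prob (cball u (rad 0 u)) = 1"
    using thr_le_measure_rad[of 0 u] prob_le_1[of "cball u (rad 0 u)"] R by (simp add: thr_def)
  then have ker0: "ker 0 u v = 1" if "v \<in> cball u (rad 0 u)" for v
    using that by (simp add: ker_def)
  have "AE v in m. v \<in> cball u (rad 0 u)"
    using \<open>prob (cball u (rad 0 u)) = 1\<close> by (rule AE_prob_1)
  then have "osc f 0 u = (\<integral>\<^sup>+v. ennreal \<bar>f u - f v\<bar> \<partial>m)"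
    unfolding osc_def avg_def by (intro nn_integral_cong_AE) (auto simp: ker0)
  moreover have "f u - (\<integral>v. f v \<partial>m) = (\<integral>v. f u - f v \<partial>m)"
    using int by (simp add: prob_space)
  moreover have "ennreal (norm (\<integral>v. f u - f v \<partial>m)) \<le> (\<integral>\<^sup>+v. norm (f u - f v) \<partial>m)"
    using int by (intro integral_norm_bound_ennreal) simp
  ultimately show ?case by simp
next
  case (Suc j)
  have [measurable]: "f \<in> borel_measurable m" by (rule continuous_measurable[OF f])
  note [measurable] = osc_measurable[OF f]
  let ?c = "\<integral>v. f v \<partial>m"
  have "ennreal \<bar>f u - ?c\<bar> = avg (Suc j) (\<lambda>_. ennreal \<bar>f u - ?c\<bar>) u"
    by (simp add: avg_const)
  also have "\<dots> \<le> avg (Suc j) (\<lambda>v. ennreal \<bar>f u - f v\<bar> + (osc f j v + chain (osc f) j v)) u"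
  proof (rule avg_mono)
    fix v
    have "ennreal \<bar>f u - ?c\<bar> \<le> ennreal (\<bar>f u - f v\<bar> + \<bar>f v - ?c\<bar>)" by (intro ennreal_leI) simp
    also have "\<dots> = ennreal \<bar>f u - f v\<bar> + ennreal \<bar>f v - ?c\<bar>" by simp
    also have "\<dots> \<le> ennreal \<bar>f u - f v\<bar> + (osc f j v + chain (osc f) j v)"
      by (intro add_left_mono Suc)
    finally show "ennreal \<bar>f u - ?c\<bar> \<le> ennreal \<bar>f u - f v\<bar> + (osc f j v + chain (osc f) j v)" .
  qed
  also have "\<dots> = osc f (Suc j) u + chain (osc f) (Suc j) u"
    unfolding osc_def[of f "Suc j"] chain.simps by (rule avg_add) measurable
  finally show ?case .
qed

text \<open>Continuity at \<open>x\<close> with radii tending to 0: the first oscillation of a chain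
  started high enough is negligible.\<close>

lemma ex_osc_le:
  assumes f: "continuous_on UNIV f" and "0 < e"
  shows "\<exists>j. osc f j x \<le> ennreal e"
proof -
  obtain d where d: "0 < d" "\<And>y. dist y x < d \<Longrightarrow> dist (f y) (f x) < e"
    using f \<open>0 < e\<close> unfolding continuous_on_iff by blast
  obtain j where "rad j x < d" using ex_rad_less[OF d(1)] by blast
  then have "osc f j x \<le> ennreal e" unfolding osc_def
  proof (intro avg_le_const ennreal_leI)
    fix v assume "dist x v \<le> rad j x"
    then have "dist v x < d" using \<open>rad j x < d\<close> by (simp add: dist_commute)
    then show "\<bar>f x - f v\<bar> \<le> e" using d(2)[of v] by (simp add: dist_real_def abs_minus_commute)
  qed
  then show ?thesis ..
qed

section \<open>The dominating measure on pairs\<close>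

text \<open>Pairs of a point \<open>u\<close> drawn from \<open>m\<close> and a random point of its
  \<open>k\<close>-th ball, weighted by \<open>R ^ k * rad k u\<close> and summed over all levels;
  neither a starting point nor \<open>f\<close> enters.\<close>

definition chain_measure :: "('a \<times> 'a) measure" where
  "chain_measure = density (m \<Otimes>\<^sub>M m) (\<lambda>(u, v). \<Sum>k. ennreal (R ^ k * rad k u * ker k u v))"

lemma sets_chain_measure: "sets chain_measure = sets borel"
  by (simp add: chain_measure_def sets_pair)

lemma nn_integral_chain_measure:
  assumes [measurable]: "G \<in> borel_measurable (m \<Otimes>\<^sub>M m)"
  shows "(\<integral>\<^sup>+z. G z \<partial>chain_measure) =
    (\<Sum>k. \<integral>\<^sup>+u. \<integral>\<^sup>+v. ennreal (R ^ k * rad k u * ker k u v) * G (u, v) \<partial>m \<partial>m)"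
proof -
  have "(\<integral>\<^sup>+z. G z \<partial>chain_measure) =
      (\<integral>\<^sup>+z. (case z of (u, v) \<Rightarrow> \<Sum>k. ennreal (R ^ k * rad k u * ker k u v)) * G z \<partial>(m \<Otimes>\<^sub>M m))"
    unfolding chain_measure_def by (rule nn_integral_density) measurable
  also have "\<dots> = (\<integral>\<^sup>+z. (\<Sum>k. (case z of (u, v) \<Rightarrow> ennreal (R ^ k * rad k u * ker k u v)) * G z) \<partial>(m \<Otimes>\<^sub>M m))"
    by (auto intro!: nn_integral_cong simp: ennreal_suminf_multc)
  also have "\<dots> = (\<Sum>k. \<integral>\<^sup>+z. (case z of (u, v) \<Rightarrow> ennreal (R ^ k * rad k u * ker k u v)) * G z \<partial>(m \<Otimes>\<^sub>M m))"
    by (rule nn_integral_suminf) measurable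
  also have "\<dots> = (\<Sum>k. \<integral>\<^sup>+u. \<integral>\<^sup>+v. ennreal (R ^ k * rad k u * ker k u v) * G (u, v) \<partial>m \<partial>m)"
    by (subst nn_integral_fst[symmetric]) auto
  finally show ?thesis .
qed

text \<open>Each kernel integrates to 1 over \<open>v\<close>, leaving the sum of
  \<open>R ^ k * rad k u\<close>, which is at most \<open>C\<close> at every
  \<open>u\<close>.\<close>

lemma emeasure_chain_measure_le: "emeasure chain_measure (space chain_measure) \<le> ennreal C"
proof -
  have "emeasure chain_measure (space chain_measure) = (\<integral>\<^sup>+z. 1 \<partial>chain_measure)" by simp
  also have "\<dots> = (\<Sum>k. \<integral>\<^sup>+u. \<integral>\<^sup>+v. ennreal (R ^ k * rad k u * ker k u v) * 1 \<partial>m \<partial>m)"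
    by (rule nn_integral_chain_measure) simp
  also have "\<dots> = (\<Sum>k. \<integral>\<^sup>+u. ennreal (R ^ k * rad k u) \<partial>m)"
  proof (intro suminf_cong nn_integral_cong)
    fix k u
    have "(\<integral>\<^sup>+v. ennreal (R ^ k * rad k u * ker k u v) * 1 \<partial>m) =
        (\<integral>\<^sup>+v. ennreal (R ^ k * rad k u) * ennreal (ker k u v) \<partial>m)"
      using R by (intro nn_integral_cong) (simp add: ennreal_mult)
    also have "\<dots> = ennreal (R ^ k * rad k u)"
      by (simp add: nn_integral_cmult nn_integral_ker)
    finally show "(\<integral>\<^sup>+v. ennreal (R ^ k * rad k u * ker k u v) * 1 \<partial>m) = ennreal (R ^ k * rad k u)" .
  qed
  also have "\<dots> = (\<integral>\<^sup>+u. (\<Sum>k. ennreal (R ^ k * rad k u)) \<partial>m)"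
    by (rule nn_integral_suminf[symmetric]) measurable
  also have "\<dots> \<le> (\<integral>\<^sup>+u. ennreal C \<partial>m)"
  proof (rule nn_integral_mono)
    fix u
    have "(\<Sum>k<N. ennreal (R ^ k * rad k u)) \<le> ennreal C" for N
      using R sum_rad[of u N] by (subst sum_ennreal) (auto intro: ennreal_leI)
    then show "(\<Sum>k. ennreal (R ^ k * rad k u)) \<le> ennreal C"
      by (intro suminf_le_const) auto
  qed
  also have "\<dots> = ennreal C" by (simp add: emeasure_space_1)
  finally show ?thesis .
qed

lemma nn_integral_cmult_pair:
  assumes F [measurable]: "F \<in> borel_measurable (m \<Otimes>\<^sub>M m)"
  shows "(\<integral>\<^sup>+u. \<integral>\<^sup>+v. c * F (u, v) \<partial>m \<partial>m) = c * (\<integral>\<^sup>+u. \<integral>\<^sup>+v. F (u, v) \<partial>m \<partial>m)"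
  using nn_integral_fst[of "\<lambda>z. c * F z" m] nn_integral_fst[of F m] nn_integral_cmult[OF F] by simp

section \<open>Young's inequality along the chain\<close>

text \<open>On the diagonal the value is 0, since \<open>0 / 0 = 0\<close> and
  \<open>0 powr p = 0\<close>.\<close>

abbreviation quot :: "('a \<Rightarrow> real) \<Rightarrow> 'a \<times> 'a \<Rightarrow> real" where
  "quot f \<equiv> (\<lambda>(u, v). (\<bar>f u - f v\<bar> / dist u v) powr p)"

lemma quot_measurable:
  assumes f: "continuous_on UNIV f"
  shows "(\<lambda>z. ennreal (quot f z)) \<in> borel_measurable (m \<Otimes>\<^sub>M m)"
proof -
  have [measurable]: "f \<in> borel_measurable m" by (rule continuous_measurable[OF f])
  have [measurable]: "(\<lambda>z. dist (fst z) (snd z)) \<in> borel_measurable (m \<Otimes>\<^sub>M m)"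
    by (intro continuous_pair_measurable continuous_intros)
  have "(\<lambda>z. ennreal ((\<bar>f (fst z) - f (snd z)\<bar> / dist (fst z) (snd z)) powr p)) \<in> borel_measurable (m \<Otimes>\<^sub>M m)"
    by measurable
  then show ?thesis by (simp add: case_prod_beta)
qed

lemma abs_diff_mean_le_young:
  fixes f :: "'a \<Rightarrow> real"
  assumes f: "continuous_on UNIV f" and bdd: "\<And>x. \<bar>f x\<bar> \<le> B"
    and \<theta>: "0 < \<theta>" and Rp: "p = 1 \<or> 2 < R"
  shows "ennreal \<bar>f x - (\<integral>v. f v \<partial>m)\<bar> \<le> ennreal ((1 - 1/p) * \<theta> * ((R - 1) / (R - 2) * C)) +
    ennreal ((1/p) * \<theta> powr (1 - p) * R powr p) * (\<integral>\<^sup>+z. ennreal (quot f z) \<partial>chain_measure)"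
proof (rule ennreal_le_epsilon)
  fix e :: real assume "0 < e"
  \<comment> \<open>The level depends on \<open>e\<close>, but the bound on the chain below is
    uniform in \<open>j\<close>.\<close>
  then obtain j where j: "osc f j x \<le> ennreal e" using ex_osc_le[OF f] by blast
  note [measurable] = quot_measurable[OF f] osc_measurable[OF f]
  define I where "I k = (\<integral>\<^sup>+u. \<integral>\<^sup>+v. ennreal (R ^ k * rad k u * ker k u v) * ennreal (quot f (u, v)) \<partial>m \<partial>m)" for k
  \<comment> \<open>The coefficient of the \<open>p\<close>-th power in \<open>powr_young\<close>
    for \<open>\<tau> = \<theta> * R ^ k\<close>; \<open>h1\<close> and \<open>h2\<close> collect
    the constant and the power part.\<close>
  define c2 where "c2 k = (1/p) * (\<theta> * R ^ k) powr (1 - p)" for k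
  have c2: "0 \<le> c2 k" for k using p by (simp add: c2_def)
  define h1 where "h1 k u = ennreal (R ^ k * rad k u)" for k u
  define h2 where "h2 k u = (\<integral>\<^sup>+v. ennreal (c2 k * rad k u * ker k u v) * ennreal (quot f (u, v)) \<partial>m)" for k u
  have h1m [measurable]: "h1 k \<in> borel_measurable m" for k
    unfolding h1_def[abs_def] by measurable
  have h2m [measurable]: "h2 k \<in> borel_measurable m" for k
    unfolding h2_def[abs_def] by measurable
  have Fm: "(\<lambda>(u, v). ennreal (a * rad k u * ker k u v) * ennreal (quot f (u, v))) \<in> borel_measurable (m \<Otimes>\<^sub>M m)" for a k
  proof -
    have "(\<lambda>z. ennreal (a * rad k (fst z) * (case z of (u, v) \<Rightarrow> ker k u v)) * ennreal (quot f z)) \<in> borel_measurable (m \<Otimes>\<^sub>M m)"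
      by measurable
    then show ?thesis by (simp add: case_prod_beta)
  qed
  let ?t = "(1 - 1/p) * \<theta>"
  have t: "0 \<le> ?t" using p \<theta> by simp
  have osc_le: "osc f k u \<le> ennreal ?t * h1 k u + h2 k u" for k u
  proof -
    have "osc f k u \<le> (\<integral>\<^sup>+v. ennreal (ker k u v) * ennreal (?t * (R ^ k * rad k u)) +
        ennreal (c2 k * rad k u * ker k u v) * ennreal (quot f (u, v)) \<partial>m)"
      unfolding osc_def avg_def
    proof (rule nn_integral_mono)
      fix v
      show "ennreal (ker k u v) * ennreal \<bar>f u - f v\<bar> \<le> ennreal (ker k u v) * ennreal (?t * (R ^ k * rad k u)) +
        ennreal (c2 k * rad k u * ker k u v) * ennreal (quot f (u, v))"
      proof (cases "dist u v \<le> rad k u")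
        case False
        then show ?thesis by (simp add: ker_eq_0)
      next
        case True
        define g where "g = \<bar>f u - f v\<bar> / dist u v"
        have g: "0 \<le> g" by (simp add: g_def)
        have "\<bar>f u - f v\<bar> \<le> dist u v * g" by (cases "u = v") (auto simp: g_def)
        also have "\<dots> \<le> rad k u * g" using True g by (rule mult_right_mono)
        also have "\<dots> \<le> rad k u * ((1 - 1/p) * (\<theta> * R ^ k) + (1/p) * (\<theta> * R ^ k) powr (1 - p) * g powr p)"
          using \<theta> p g R by (intro mult_left_mono powr_young) auto
        also have "\<dots> = ?t * (R ^ k * rad k u) + c2 k * rad k u * g powr p"
          by (simp add: c2_def algebra_simps)
        finally have "ker k u v * \<bar>f u - f v\<bar> \<le> ker k u v * (?t * (R ^ k * rad k u) + c2 k * rad k u * g powr p)"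
          by (rule mult_left_mono) simp
        also have "\<dots> = ker k u v * (?t * (R ^ k * rad k u)) + c2 k * rad k u * ker k u v * g powr p"
          by (simp add: algebra_simps)
        finally show ?thesis using t c2[of k] R
          by (simp add: g_def flip: ennreal_mult ennreal_plus)
      qed
    qed
    also have "\<dots> = (\<integral>\<^sup>+v. ennreal (ker k u v) * ennreal (?t * (R ^ k * rad k u)) \<partial>m) + h2 k u"
      unfolding h2_def by (rule nn_integral_add) (measurable, simp_all add: space_m)
    also have "(\<integral>\<^sup>+v. ennreal (ker k u v) * ennreal (?t * (R ^ k * rad k u)) \<partial>m) = ennreal ?t * h1 k u"
      using t R by (simp add: nn_integral_multc nn_integral_ker h1_def ennreal_mult)
    finally show ?thesis .
  qed
  have "chain (osc f) j x \<le> chain (\<lambda>k u. ennreal ?t * h1 k u + h2 k u) j x"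
    by (rule chain_mono[OF osc_le])
  also have "\<dots> = ennreal ?t * chain h1 j x + chain h2 j x"
    by (subst chain_add) (auto simp: chain_cmult)
  also have "ennreal ?t * chain h1 j x \<le> ennreal (?t * ((R - 1) / (R - 2) * C))"
  \<comment> \<open>For \<open>p = 1\<close> the coefficient \<open>?t\<close> is 0, so the bound
    holds even where \<open>R - 2 = 0\<close>.\<close>
  proof (cases "p = 1")
    case False
    then have "chain h1 j x \<le> ennreal ((R - 1) / (R - 2) * C)"
      using Rp chain_rad_le[of j x] unfolding h1_def[abs_def] by blast
    then have "ennreal ?t * chain h1 j x \<le> ennreal ?t * ennreal ((R - 1) / (R - 2) * C)"
      by (rule mult_left_mono) simp
    also have "\<dots> = ennreal (?t * ((R - 1) / (R - 2) * C))"
      using t R C_nonneg by (intro ennreal_mult[symmetric]) auto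
    finally show ?thesis .
  qed simp
  also have "chain h2 j x \<le> (\<Sum>k<j. ennreal (R powr (p * real (Suc k))) * (\<integral>\<^sup>+v. h2 k v \<partial>m))"
    by (rule chain_le_integral) simp
  also have "\<dots> = (\<Sum>k<j. ennreal ((1/p) * \<theta> powr (1 - p) * R powr p) * I k)"
  proof (rule sum.cong[OF refl])
    fix k
    \<comment> \<open>This identity explains the choice of \<tau>: the density bound at level
      \<open>k\<close> times the Young coefficient is a constant times \<open>R ^ k\<close>, the
      weight in \<open>chain_measure\<close>.\<close>
    have e: "R powr (p * real (Suc k)) * c2 k = (1/p) * \<theta> powr (1 - p) * R powr p * R ^ k"
    proof -
      have "(\<theta> * R ^ k) powr (1 - p) = \<theta> powr (1 - p) * R powr (real k * (1 - p))"
        using \<theta> R by (simp add: powr_mult powr_powr flip: powr_realpow)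
      moreover have "R powr (p * real (Suc k)) * R powr (real k * (1 - p)) = R powr p * R ^ k"
        using R by (simp flip: powr_add powr_realpow add: algebra_simps)
      ultimately show ?thesis unfolding c2_def by (simp add: mult_ac)
    qed
    have "ennreal (R powr (p * real (Suc k))) * (\<integral>\<^sup>+v. h2 k v \<partial>m) =
      (\<integral>\<^sup>+u. \<integral>\<^sup>+v. ennreal (R powr (p * real (Suc k))) * (ennreal (c2 k * rad k u * ker k u v) * ennreal (quot f (u, v))) \<partial>m \<partial>m)"
      unfolding h2_def
      using nn_integral_cmult_pair[OF Fm[of "c2 k" k]]
      by simp
    also have "\<dots> = (\<integral>\<^sup>+u. \<integral>\<^sup>+v. ennreal ((1/p) * \<theta> powr (1 - p) * R powr p) *
        (ennreal (R ^ k * rad k u * ker k u v) * ennreal (quot f (u, v))) \<partial>m \<partial>m)"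
    proof (intro nn_integral_cong)
      fix u v
      have "ennreal (R powr (p * real (Suc k))) * ennreal (c2 k * rad k u * ker k u v) =
        ennreal (R powr (p * real (Suc k)) * c2 k * (rad k u * ker k u v))"
        using c2[of k] by (simp add: mult.assoc flip: ennreal_mult)
      also have "\<dots> = ennreal ((1/p) * \<theta> powr (1 - p) * R powr p) * ennreal (R ^ k * rad k u * ker k u v)"
        unfolding e using p R by (simp add: mult.assoc flip: ennreal_mult)
      finally show "ennreal (R powr (p * real (Suc k))) * (ennreal (c2 k * rad k u * ker k u v) * ennreal (quot f (u, v))) =
        ennreal ((1/p) * \<theta> powr (1 - p) * R powr p) * (ennreal (R ^ k * rad k u * ker k u v) * ennreal (quot f (u, v)))"
        by (simp only: mult.assoc[symmetric])
    qed
    also have "\<dots> = ennreal ((1/p) * \<theta> powr (1 - p) * R powr p) * I k"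
      unfolding I_def
      using nn_integral_cmult_pair[OF Fm[of "R ^ k" k]]
      by simp
    finally show "ennreal (R powr (p * real (Suc k))) * (\<integral>\<^sup>+v. h2 k v \<partial>m) =
      ennreal ((1/p) * \<theta> powr (1 - p) * R powr p) * I k" .
  qed
  also have "\<dots> = ennreal ((1/p) * \<theta> powr (1 - p) * R powr p) * (\<Sum>k<j. I k)"
    by (rule sum_distrib_left[symmetric])
  also have "\<dots> \<le> ennreal ((1/p) * \<theta> powr (1 - p) * R powr p) * (\<Sum>k. I k)"
    by (intro mult_left_mono sum_le_suminf) auto
  also have "(\<Sum>k. I k) = (\<integral>\<^sup>+z. ennreal (quot f z) \<partial>chain_measure)"
    unfolding I_def by (rule nn_integral_chain_measure[symmetric]) measurable
  finally have chain_le: "chain (osc f) j x \<le> ennreal (?t * ((R - 1) / (R - 2) * C)) +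
      ennreal ((1/p) * \<theta> powr (1 - p) * R powr p) * (\<integral>\<^sup>+z. ennreal (quot f z) \<partial>chain_measure)"
    by (simp add: add_left_mono add_right_mono)
  have "ennreal \<bar>f x - (\<integral>v. f v \<partial>m)\<bar> \<le> chain (osc f) j x + osc f j x"
    using abs_diff_mean_le_chain[OF f bdd, of x j] by (simp only: add.commute)
  also note add_mono[OF chain_le j]
  finally show "ennreal \<bar>f x - (\<integral>v. f v \<partial>m)\<bar> \<le> ennreal (?t * ((R - 1) / (R - 2) * C)) +
      ennreal ((1/p) * \<theta> powr (1 - p) * R powr p) * (\<integral>\<^sup>+z. ennreal (quot f z) \<partial>chain_measure) + ennreal e" .
qed

section \<open>Normalisation, optimisation and truncation\<close>

lemma ex_prob_dominating_chain_measure: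
  obtains \<nu> :: "('a \<times> 'a) measure" where "prob_space \<nu>" "sets \<nu> = sets borel"
    "\<And>G. G \<in> borel_measurable borel \<Longrightarrow> (\<integral>\<^sup>+z. G z \<partial>chain_measure) \<le> ennreal C * (\<integral>\<^sup>+z. G z \<partial>\<nu>)"
proof (cases "emeasure chain_measure (space chain_measure) = 0")
  case True
  have "(\<integral>\<^sup>+z. G z \<partial>chain_measure) = 0" for G
  proof -
    have "space chain_measure \<in> null_sets chain_measure" using True by (simp add: null_sets_def)
    then have "(\<integral>\<^sup>+z\<in>space chain_measure. G z \<partial>chain_measure) = 0" by (rule nn_integral_null_set)
    moreover have "(\<integral>\<^sup>+z\<in>space chain_measure. G z \<partial>chain_measure) = (\<integral>\<^sup>+z. G z \<partial>chain_measure)"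
      by (rule nn_integral_cong) simp
    ultimately show ?thesis by simp
  qed
  \<comment> \<open>With zero total mass there is nothing to dominate, and a Dirac measure
    serves.\<close>
  then show ?thesis
    by (intro that[of "return borel undefined"] prob_space_return) auto
next
  case False
  define M where "M = emeasure chain_measure (space chain_measure)"
  have M: "M \<noteq> 0" "M \<le> ennreal C" using False emeasure_chain_measure_le by (auto simp: M_def)
  then have "M \<noteq> \<top>" by (metis ennreal_less_top linorder_not_le top.extremum_strict top.not_eq_extremum)
  have inv: "M * inverse M = 1" using M \<open>M \<noteq> \<top>\<close>
    by (metis ennreal_divide_self divide_ennreal_def top.not_eq_extremum)
  define \<nu> where "\<nu> = scale_measure (inverse M) chain_measure"
  show ?thesis
  proof (rule that[of \<nu>])
    show "prob_space \<nu>"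
      by (rule prob_spaceI) (use inv in \<open>simp add: \<nu>_def space_scale_measure M_def mult.commute\<close>)
    show "sets \<nu> = sets borel" by (simp add: \<nu>_def sets_chain_measure)
    fix G :: "'a \<times> 'a \<Rightarrow> ennreal" assume "G \<in> borel_measurable borel"
    then have "G \<in> borel_measurable chain_measure"
      using measurable_cong_sets[OF sets_chain_measure refl] by blast
    then have "M * (\<integral>\<^sup>+z. G z \<partial>\<nu>) = (M * inverse M) * (\<integral>\<^sup>+z. G z \<partial>chain_measure)"
      unfolding \<nu>_def by (simp add: nn_integral_scale_measure mult.assoc)
    then have "(\<integral>\<^sup>+z. G z \<partial>chain_measure) = M * (\<integral>\<^sup>+z. G z \<partial>\<nu>)" using inv by simp
    also have "\<dots> \<le> ennreal C * (\<integral>\<^sup>+z. G z \<partial>\<nu>)" by (intro mult_right_mono M) simp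
    finally show "(\<integral>\<^sup>+z. G z \<partial>chain_measure) \<le> ennreal C * (\<integral>\<^sup>+z. G z \<partial>\<nu>)" .
  qed
qed

text \<open>\<open>optimize_young\<close> bounds the distance of \<open>f s\<close> and of
  \<open>f t\<close> from the mean, whence the factor 2. For \<open>p = 1\<close> the base
  \<open>a\<close> has exponent 0, so any positive value may stand in for the quotient by
  \<open>R - 2\<close>.\<close>

lemma powr_abs_diff_le_bounded:
  fixes f :: "'a \<Rightarrow> real"
  assumes f: "continuous_on UNIV f" and bdd: "\<And>x. \<bar>f x\<bar> \<le> B"
    and Rp: "p = 1 \<or> 2 < R"
    and a: "0 < a" "p = 1 \<or> a = (R - 1) / (R - 2) * C"
    and X: "0 \<le> X" "(\<integral>\<^sup>+z. ennreal (quot f z) \<partial>chain_measure) \<le> ennreal (C * X)"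
  shows "\<bar>f s - f t\<bar> powr p \<le> (2 * (a powr (1 - 1/p) * (R powr p * C) powr (1/p))) powr p * X"
proof -
  let ?c = "\<integral>v. f v \<partial>m"
  let ?K = "a powr (1 - 1/p) * (R powr p * C) powr (1/p)"
  have b: "0 \<le> R powr p * C * X" using C_nonneg X by simp
  have le: "\<bar>f x - ?c\<bar> \<le> a powr (1 - 1/p) * (R powr p * C * X) powr (1/p)" for x
  proof (rule optimize_young[OF p a(1) b])
    fix \<theta> :: real assume \<theta>: "0 < \<theta>"
    have "ennreal \<bar>f x - ?c\<bar> \<le> ennreal ((1 - 1/p) * \<theta> * ((R - 1) / (R - 2) * C)) +
        ennreal ((1/p) * \<theta> powr (1 - p) * R powr p) * (\<integral>\<^sup>+z. ennreal (quot f z) \<partial>chain_measure)"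
      by (rule abs_diff_mean_le_young[OF f bdd \<theta> Rp])
    also have "\<dots> \<le> ennreal ((1 - 1/p) * \<theta> * ((R - 1) / (R - 2) * C)) +
        ennreal ((1/p) * \<theta> powr (1 - p) * R powr p) * ennreal (C * X)"
      by (intro add_left_mono mult_left_mono X) simp
    also have "(1 - 1/p) * \<theta> * ((R - 1) / (R - 2) * C) = (1 - 1/p) * \<theta> * a"
      using a(2) by auto
    also have "ennreal ((1 - 1/p) * \<theta> * a) + ennreal ((1/p) * \<theta> powr (1 - p) * R powr p) * ennreal (C * X) =
        ennreal ((1 - 1/p) * \<theta> * a + (1/p) * \<theta> powr (1 - p) * (R powr p * C * X))"
      using p \<theta> a C_nonneg X by (simp add: mult.assoc flip: ennreal_mult ennreal_plus)
    finally show "\<bar>f x - ?c\<bar> \<le> (1 - 1/p) * \<theta> * a + (1/p) * \<theta> powr (1 - p) * (R powr p * C * X)"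
      by (rule ennreal_le_iff[THEN iffD1, rotated]) (use p \<theta> a C_nonneg X in \<open>simp add: add_nonneg_nonneg\<close>)
  qed
  have "(R powr p * C * X) powr (1/p) = (R powr p * C) powr (1/p) * X powr (1/p)"
    using C_nonneg X by (intro powr_mult)
  then have "\<bar>f s - f t\<bar> \<le> 2 * ?K * X powr (1/p)"
    using le[of s] le[of t] by (simp add: mult.assoc)
  then have "\<bar>f s - f t\<bar> powr p \<le> (2 * ?K * X powr (1/p)) powr p"
    using p by (intro powr_mono2) auto
  also have "\<dots> = (2 * ?K) powr p * X"
    using p X by (subst powr_mult) (auto simp: powr_powr)
  finally show ?thesis .
qed

text \<open>Optimisation asks for positive \<open>a\<close>, so \<open>C = 0\<close> is treated
  directly: both terms of the Young bound vanish and \<open>f\<close> equals its mean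
  everywhere.\<close>

lemma constant_if_C_eq_0:
  fixes f :: "'a \<Rightarrow> real"
  assumes f: "continuous_on UNIV f" and bdd: "\<And>x. \<bar>f x\<bar> \<le> B"
    and Rp: "p = 1 \<or> 2 < R" and C: "C = 0"
    and zero: "(\<integral>\<^sup>+z. ennreal (quot f z) \<partial>chain_measure) = 0"
  shows "f s = f t"
proof -
  have "\<bar>f x - (\<integral>v. f v \<partial>m)\<bar> \<le> 0" for x
    using abs_diff_mean_le_young[OF f bdd zero_less_one Rp, of x] by (simp add: C zero)
  from this[of s] this[of t] show ?thesis by simp
qed

lemma powr_abs_diff_le:
  fixes f :: "'a \<Rightarrow> real"
  assumes f: "continuous_on UNIV f"
    and Rp: "p = 1 \<or> 2 < R"
    and a: "0 < C \<Longrightarrow> 0 < a" "p = 1 \<or> a = (R - 1) / (R - 2) * C"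
    and K: "0 < C \<Longrightarrow> 0 < K \<and> a powr (1 - 1/p) * (R powr p * C) powr (1/p) \<le> K"
    and le: "(\<integral>\<^sup>+z. ennreal (quot f z) \<partial>chain_measure) \<le> ennreal C * J"
  shows "ennreal (\<bar>f s - f t\<bar> powr p) \<le> ennreal ((2 * K) powr p) * J"
proof -
  define B where "B = max \<bar>f s\<bar> \<bar>f t\<bar>"
  \<comment> \<open>Clipping at \<open>B\<close> keeps the values at \<open>s\<close> and
    \<open>t\<close> and does not increase any difference quotient.\<close>
  define g where "g x = max (- B) (min B (f x))" for x
  have B: "0 \<le> B" by (simp add: B_def)
  have g: "continuous_on UNIV g" unfolding g_def by (intro continuous_intros f)
  have gB: "\<bar>g x\<bar> \<le> B" for x using B by (auto simp: g_def)
  have gst: "g s = f s" "g t = f t" by (auto simp: g_def B_def)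
  have "\<bar>g u - g v\<bar> \<le> \<bar>f u - f v\<bar>" for u v by (auto simp: g_def)
  then have "quot g z \<le> quot f z" for z
    using p by (auto split: prod.split intro!: powr_mono2 divide_right_mono)
  then have "(\<integral>\<^sup>+z. ennreal (quot g z) \<partial>chain_measure) \<le> (\<integral>\<^sup>+z. ennreal (quot f z) \<partial>chain_measure)"
    by (intro nn_integral_mono ennreal_leI)
  with le have le': "(\<integral>\<^sup>+z. ennreal (quot g z) \<partial>chain_measure) \<le> ennreal C * J" by simp
  show ?thesis
  proof (cases "C = 0")
    case True
    then have "f s = f t"
      using constant_if_C_eq_0[OF g gB Rp True, of s t] le' gst by simp
    then show ?thesis by simp
  next
    case False
    with C_nonneg have C: "0 < C" by simp
    show ?thesis
    proof (cases J)
      case (real X)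
      have "(\<integral>\<^sup>+z. ennreal (quot g z) \<partial>chain_measure) \<le> ennreal (C * X)"
        using le' real C by (simp add: ennreal_mult)
      from powr_abs_diff_le_bounded[OF g gB Rp a(1)[OF C] a(2) real(1) this, of s t]
      have "\<bar>f s - f t\<bar> powr p \<le> (2 * (a powr (1 - 1/p) * (R powr p * C) powr (1/p))) powr p * X"
        by (simp add: gst)
      also have "\<dots> \<le> (2 * K) powr p * X"
        using K[OF C] real p by (intro mult_right_mono powr_mono2) auto
      finally show ?thesis using real by (simp add: ennreal_leI flip: ennreal_mult)
    next
      \<comment> \<open>The right side is infinite because \<open>K\<close> is positive.\<close>
      case top
      then show ?thesis using K[OF C] by (simp add: ennreal_mult_top)
    qed
  qed
qed

end

section \<open>Finite diameter and choice of parameters\<close>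

text \<open>Ball masses are at most 1, so the integrand is at least 1 and the integral is at least
  the length of its range.\<close>

lemma ediameter_finite:
  fixes m :: "'a::metric_space measure"
  assumes "prob_space m" and p: "1 \<le> p"
    and pos: "\<And>e. 0 < e \<Longrightarrow> 0 < measure m (cball x e)"
    and fin: "majorizing_integral m p x < \<infinity>"
  shows "ediameter (UNIV :: 'a set) < \<infinity>"
proof (rule ccontr)
  interpret prob_space m by fact
  assume "\<not> ediameter (UNIV :: 'a set) < \<infinity>"
  then have top: "ediameter (UNIV :: 'a set) = \<top>" by (simp add: not_less top_unique)
  have "ennreal (real n) \<le> majorizing_integral m p x" for n
  proof -
    have "ennreal (real n) = (\<integral>\<^sup>+e. indicator {0<..<real n} e \<partial>lborel)" by simp
    also have "\<dots> \<le> majorizing_integral m p x"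
      unfolding majorizing_integral_def
    proof (rule nn_integral_mono)
      fix e :: real
      have "1 \<le> (1 / measure m (cball x e)) powr (1/p)" if "0 < e"
        using pos[OF that] prob_le_1[of "cball x e"] p by (intro ge_one_powr_ge_zero) auto
      then show "indicator {0<..<real n} e \<le> ennreal ((1 / measure m (cball x e)) powr (1/p)) *
          indicator {\<epsilon>. 0 < \<epsilon> \<and> ennreal \<epsilon> \<le> ediameter (UNIV :: 'a set)} e"
        by (auto simp: indicator_def top)
    qed
    finally show ?thesis .
  qed
  moreover obtain n where "majorizing_integral m p x < of_nat n"
    using fin ennreal_Ex_less_of_nat by auto
  ultimately show False by (metis ennreal_of_nat_eq_real_of_nat leD)
qed

theorem proposition2p1:
  fixes m :: "'a::metric_space measure" and p :: real
  assumes "prob_space m"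
    and "sets m = sets (borel :: 'a measure)"
    and "measure_support m = UNIV"
    and "p \<ge> 1"
    and "majorizing_sup m p < \<infinity>"
  shows "\<exists>\<nu> :: ('a \<times> 'a) measure.
    prob_space \<nu> \<and> sets \<nu> = sets (borel :: ('a \<times> 'a) measure) \<and>
    (\<forall>f :: 'a \<Rightarrow> real. continuous_on UNIV f \<longrightarrow>
      (SUP s. SUP t. ennreal (\<bar>f s - f t\<bar> powr p))
        \<le> ennreal ((2 * K_const p (enn2real (majorizing_sup m p))) powr p) *
          (\<integral>\<^sup>+ (u, v). ennreal ((\<bar>f u - f v\<bar> / dist u v) powr p) \<partial>\<nu>))"
proof -
  interpret prob_space m by fact
  define S where "S = enn2real (majorizing_sup m p)"
  have S: "0 \<le> S" "majorizing_sup m p = ennreal S" using assms(5) by (auto simp: S_def)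
  have int_le: "majorizing_integral m p x \<le> ennreal S" for x
    unfolding S(2)[symmetric] majorizing_sup_def by (rule SUP_upper) simp
  have pos: "0 < measure m (cball x e)" if "0 < e" for x e
  proof -
    have "x \<in> measure_support m" using assms(3) by simp
    then have "0 < emeasure m (ball x e)" using that by (auto simp: measure_support_def)
    also have "\<dots> \<le> emeasure m (cball x e)" by (intro emeasure_mono) (auto simp: assms(2))
    finally show ?thesis by (simp add: emeasure_eq_measure)
  qed
  have "ediameter (UNIV :: 'a set) < \<infinity>"
    using int_le[of undefined] le_less_trans[of _ "ennreal S" \<infinity>]
    by (intro ediameter_finite[OF assms(1,4) pos, of undefined]) auto
  then obtain D where D: "0 \<le> D" "ediameter (UNIV :: 'a set) = ennreal D"
    by (cases "ediameter (UNIV :: 'a set)") auto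
  have diam: "dist x y \<le> D" for x y :: 'a
  proof -
    have "ennreal (dist x y) \<le> ediameter (UNIV :: 'a set)"
      unfolding ediameter_def
      by (rule SUP_upper2[where i = x], simp, rule SUP_upper2[where i = y], simp_all)
    then show ?thesis using D by simp
  qed
  \<comment> \<open>This \<open>s\<close> is the one for which
    \<open>chaining_constant_le_K_const\<close> compares with \<open>K_const\<close>; for
    \<open>p = 1\<close> it is 0 and \<open>R = 2\<close>.\<close>
  define s where "s = sqrt (1 - 1/p)"
  define R where "R = 2 + s"
  have s: "0 \<le> s" "p \<noteq> 1 \<Longrightarrow> 0 < s" "p = 1 \<Longrightarrow> s = 0" using assms(4) by (auto simp: s_def)
  \<comment> \<open>\<open>C\<close> is \<open>S\<close> divided by \<open>1 - 1/R\<close>, the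
    factor in \<open>sum_rad_le_integral\<close>.\<close>
  define C where "C = S * R / (1 + s)"
  interpret majorizing_chain m p R D
    by unfold_locales (use assms(2,4) s diam in \<open>auto simp: R_def\<close>)
  interpret bounded_majorizing_chain m p R D C
  proof
    fix x N
    have "ennreal ((1 - 1/R) * (\<Sum>k<N. R ^ k * rad k x)) \<le> ennreal S"
      using sum_rad_le_integral[OF pos, of x N] int_le[of x] D by (simp add: order_trans)
    then have "(1 - 1/R) * (\<Sum>k<N. R ^ k * rad k x) \<le> S" using S by simp
    moreover have "1 - 1/R = (1 + s) / R" using s by (simp add: R_def field_simps)
    ultimately show "(\<Sum>k<N. R ^ k * rad k x) \<le> C"
      using s R by (simp add: C_def field_simps)
  qed
  obtain \<nu> where \<nu>: "prob_space \<nu>" "sets \<nu> = sets borel"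
    "\<And>G. G \<in> borel_measurable borel \<Longrightarrow> (\<integral>\<^sup>+z. G z \<partial>chain_measure) \<le> ennreal C * (\<integral>\<^sup>+z. G z \<partial>\<nu>)"
    using ex_prob_dominating_chain_measure by blast
  define a where "a = (if p = 1 then 1 else (R - 1) / (R - 2) * C)"
  have S_pos: "0 < S" if "0 < C"
    using that S by (cases "S = 0") (auto simp: C_def)
  have a_pos: "0 < a" if "0 < C" using that s R by (auto simp: a_def R_def)
  have K: "0 < K_const p S \<and> a powr (1 - 1/p) * (R powr p * C) powr (1/p) \<le> K_const p S" if "0 < C"
  proof (cases "p = 1")
    \<comment> \<open>Here \<open>R = 2\<close> and \<open>C = 2 * S\<close>, and both sides equal
      \<open>4 * S\<close>.\<close>
    case True
    then show ?thesis using S_pos[OF that] s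
      by (simp add: K_const_def K_factor_def a_def R_def C_def)
  next
    case False
    have "a = S * (2 + s) / s" using False s by (simp add: a_def R_def C_def)
    then have "a powr (1 - 1/p) * (R powr p * C) powr (1/p) \<le> K_const p S"
      using chaining_constant_le_K_const[OF _ S_pos[OF that] s_def] False assms(4)
      by (simp add: R_def C_def)
    moreover have "0 < a powr (1 - 1/p) * (R powr p * C) powr (1/p)"
      using a_pos[OF that] that R_gt1 by (intro mult_pos_pos) auto
    ultimately show ?thesis by linarith
  qed
  have bound: "(SUP s. SUP t. ennreal (\<bar>f s - f t\<bar> powr p)) \<le> ennreal ((2 * K_const p S) powr p) *
      (\<integral>\<^sup>+z. ennreal (quot f z) \<partial>\<nu>)" if f: "continuous_on UNIV f" for f :: "'a \<Rightarrow> real"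
  proof (intro SUP_least)
    fix x y
    have "(\<lambda>z. ennreal (quot f z)) \<in> borel_measurable borel"
      using quot_measurable[OF f] measurable_cong_sets[OF sets_pair refl] by blast
    then have "(\<integral>\<^sup>+z. ennreal (quot f z) \<partial>chain_measure) \<le> ennreal C * (\<integral>\<^sup>+z. ennreal (quot f z) \<partial>\<nu>)"
      by (rule \<nu>(3))
    then show "ennreal (\<bar>f x - f y\<bar> powr p) \<le> ennreal ((2 * K_const p S) powr p) *
        (\<integral>\<^sup>+z. ennreal (quot f z) \<partial>\<nu>)"
      by (intro powr_abs_diff_le[OF f _ a_pos _ K]) (use s in \<open>auto simp: a_def R_def\<close>)
  qed
  have quot_eq: "(\<integral>\<^sup>+(u, v). ennreal ((\<bar>f u - f v\<bar> / dist u v) powr p) \<partial>\<nu>) =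
      (\<integral>\<^sup>+z. ennreal (quot f z) \<partial>\<nu>)" for f :: "'a \<Rightarrow> real"
    by (rule nn_integral_cong) (simp split: prod.split)
  show ?thesis
    by (intro exI[of _ \<nu>] conjI allI impI \<nu>(1,2)) (unfold S_def[symmetric] quot_eq, rule bound)
qed

end
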